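(* Fix a positive integer $n$ and a number $V$. Let $C\subseteq\mathbb{R}^n$ be the positive orthant. Then there are only finitely many $n$-tuples $(B_1,\ldots,B_n)$ of lattice polyhedra $B_i\subseteq C$ with each $C\setminus B_i$ bounded that are minimal with mixed volume $V$.
   Context: A lattice polyhedron is an intersection of finitely many closed half-spaces all of whose vertices lie in $\mathbb{Z}^n$. Lattice volume is $n!$ times Euclidean volume. For polyhedra $B\subseteq C$ with $C\setminus B$ bounded, put $\mathrm{V}(C,B)=$ lattice volume of $C\setminus B$, and define the relative mixed volume $\mathrm{Vol}_C((C,B_1),\ldots,(C,B_n))=\sum_{I\subseteq\{1,\ldots,n\}}(-1)^{n-|I|}\,\mathrm{V}\big(C,\sum_{i\in I}B_i\big)$ (Minkowski sums; empty sum $=C$); it is the unique symmetric, Minkowski-multilinear function with $\mathrm{Vol}_C((C,B),\ldots,(C,B))=\mathrm{V}(C,B)$. A tuple $(B_1,\ldots,B_n)$ is minimal with mixed volume $V$ if $\mathrm{Vol}_C((C,B_1),\ldots,(C,B_n))=V$ and, for every $i$ and every point $\delta\in C\setminus B_i$, replacing $B_i$ by $\mathrm{conv}(B_i\cup\{\delta\})$ gives mixed volume strictly less than $V$. *)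

theory Defs
  imports "HOL-Analysis.Analysis"
begin

definition lattice_polyhedron :: "(real ^ 'n) set \<Rightarrow> bool" where
  "lattice_polyhedron P \<longleftrightarrow>
     polyhedron P \<and> (\<forall>v. v extreme_point_of P \<longrightarrow> (\<forall>j. v $ j \<in> \<int>))"

definition positive_orthant :: "(real ^ 'n) set" where
  "positive_orthant = {x. \<forall>j. 0 \<le> x $ j}"

definition rel_volume :: "(real ^ 'n) set \<Rightarrow> (real ^ 'n) set \<Rightarrow> real" where
  "rel_volume C B = fact CARD('n) * measure lebesgue (C - B)"

(* The library's empty Minkowski sum is {0}; for subsets of C with bounded
   complement the neutral element has to be C. *)
definition rel_minkowski_sum ::
  "(real ^ 'n) set \<Rightarrow> ('n \<Rightarrow> (real ^ 'n) set) \<Rightarrow> 'n set \<Rightarrow> (real ^ 'n) set" where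
  "rel_minkowski_sum C B I = (if I = {} then C else (\<Sum>i\<in>I. B i))"

(* An n-tuple of subsets of R^n is a function on the index type 'n of the coordinates.
   Normalisation: this alternating sum of lattice volumes takes the value
   fact CARD('n) * rel_volume C B on the constant tuple (B, ..., B).  The multilinear
   function that takes the value rel_volume C B there is 1 / fact CARD('n) times this one,
   so passing from one convention to the other only rescales the number V in
   minimal_tuple below. *)
definition rel_mixed_volume ::
  "(real ^ 'n) set \<Rightarrow> ('n \<Rightarrow> (real ^ 'n) set) \<Rightarrow> real" where
  "rel_mixed_volume C B =
     (\<Sum>I\<in>Pow UNIV. (-1) ^ (CARD('n) - card I) * rel_volume C (rel_minkowski_sum C B I))"

definition minimal_tuple ::
  "(real ^ 'n) set \<Rightarrow> real \<Rightarrow> ('n \<Rightarrow> (real ^ 'n) set) \<Rightarrow> bool" where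
  "minimal_tuple C V B \<longleftrightarrow>
     rel_mixed_volume C B = V \<and>
     (\<forall>i. \<forall>\<delta> \<in> C - B i.
        rel_mixed_volume C (B(i := convex hull (B i \<union> {\<delta>}))) < V)"

end

theory Submission
  imports Defs
begin

text \<open>
  The tuple of finite sets of lattice points missed by the \<open>B\<^sub>i\<close> is a tuple of finite down-sets of
  \<open>\<nat>\<^sup>n\<close>, and by Higman's lemma every infinite sequence of such tuples has two members with the
  earlier one contained in the later one. As a lattice polyhedron is determined by its lattice
  points, infinitely many minimal tuples would give two of them, \<open>B \<noteq> B'\<close> with \<open>B\<^sub>i \<subseteq> B'\<^sub>i\<close> for
  all \<open>i\<close>. Adding to some \<open>B\<^sub>i\<close> a point of \<open>B'\<^sub>i - B\<^sub>i\<close> lowers the mixed volume below \<open>V\<close>, and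
  enlarging further to \<open>B'\<close> does not raise it, which contradicts that \<open>B'\<close> has mixed volume \<open>V\<close>.

  It remains to show that the relative mixed volume decreases when the \<open>B\<^sub>i\<close> grow. Cutting all
  sets with a large simplex reduces this to monotonicity of the mixed volume of polytopes
  \<open>K\<^sub>i = conv A\<^sub>i\<close>. The gradient of \<open>f\<^sub>i x = ln (\<Sum>a\<in>A\<^sub>i. c\<^sub>i a * exp (a \<bullet> x))\<close> maps onto the interior
  of \<open>K\<^sub>i\<close>, and likewise for sums, so the mixed volume is the integral of the mixed discriminant
  of the Hessians of the \<open>f\<^sub>i\<close>, which is pointwise nonnegative, and this holds for all positive
  weights \<open>c\<^sub>i\<close>. Letting the weights of the additional points of a larger configuration tend to 0,
  Fatou's lemma gives the monotonicity.
\<close>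

section \<open>Well-quasi-ordering of tuples of finite down-sets\<close>

definition dominated :: "('a \<Rightarrow> 'a \<Rightarrow> bool) \<Rightarrow> 'a set \<Rightarrow> 'a set \<Rightarrow> bool" where
  "dominated r A B \<longleftrightarrow> (\<forall>a\<in>A. \<exists>b\<in>B. r a b)"

text \<open>Higman's lemma for finite sets, by a minimal bad sequence: bad sequences are compared by the
  cardinalities of their members, and removing one element from each member of a suitable
  subsequence contradicts minimality.\<close>

lemma dominated_good_pair:
  fixes D :: "nat \<Rightarrow> 'a set"
  assumes sub: "\<And>f :: nat \<Rightarrow> 'a. range f \<subseteq> X \<Longrightarrow>
      \<exists>\<phi> :: nat \<Rightarrow> nat. strict_mono \<phi> \<and> (\<forall>k l. k < l \<longrightarrow> r (f (\<phi> k)) (f (\<phi> l)))"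
    and D: "\<And>k. finite (D k)" "\<And>k. D k \<subseteq> X"
  shows "\<exists>k l. k < l \<and> dominated r (D k) (D l)"
proof (rule ccontr)
  assume contra: "\<not> ?thesis"
  define bad where "bad f \<longleftrightarrow> (\<forall>k. finite (f k) \<and> f k \<subseteq> X) \<and> (\<forall>k l. k < l \<longrightarrow> \<not> dominated r (f k) (f l))"
    for f :: "nat \<Rightarrow> 'a set"
  have badD: "bad D" using contra D by (auto simp: bad_def)
  define P where "P n f \<longleftrightarrow> bad f \<and> (\<forall>h. bad h \<and> (\<forall>i<n. h i = f i) \<longrightarrow> card (f n) \<le> card (h n))"
    for n f
  have least: "\<exists>f'. P n f' \<and> (\<forall>i<n. f' i = f i)" if "bad f" for f n
  proof -
    have "\<exists>f'. (bad f' \<and> (\<forall>i<n. f' i = f i)) \<and>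
        (\<forall>h. bad h \<and> (\<forall>i<n. h i = f i) \<longrightarrow> card (f' n) \<le> card (h n))"
      by (rule ex_has_least_nat[of "\<lambda>h. bad h \<and> (\<forall>i<n. h i = f i)" f "\<lambda>h. card (h n)"]) (simp add: that)
    then obtain f' where "bad f' \<and> (\<forall>i<n. f' i = f i)"
        "\<forall>h. bad h \<and> (\<forall>i<n. h i = f i) \<longrightarrow> card (f' n) \<le> card (h n)"
      by blast
    then show ?thesis unfolding P_def by (intro exI[of _ f']) auto
  qed
  obtain F where F: "\<And>n. P n (F n)" "\<And>n i. i \<le> n \<Longrightarrow> F (Suc n) i = F n i"
  proof -
    have "\<exists>f. \<forall>n. P n (f n) \<and> (\<forall>i<Suc n. f (Suc n) i = f n i)"
    proof (rule dependent_nat_choice)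
      show "\<exists>x. P 0 x" using least[OF badD, of 0] by auto
      show "\<exists>y. P (Suc n) y \<and> (\<forall>i<Suc n. y i = x i)" if "P n x" for x n
        using that least[of x "Suc n"] by (simp add: P_def)
    qed
    then show ?thesis using that by (metis less_Suc_eq_le)
  qed
  \<comment> \<open>From stage \<open>n\<close> on, position \<open>n\<close> no longer changes, so
    this diagonal sequence agrees with \<open>F n\<close> up to \<open>n\<close>. It is bad, and
    each of its members is as small as the earlier members allow.\<close>
  define m where "m n = F n n" for n
  have Fm: "F n i = m i" if "i \<le> n" for i n
    using that
  proof (induction n rule: dec_induct)
    case base then show ?case by (simp add: m_def)
  next
    case (step n) then show ?case using F(2)[of i n] by simp
  qed
  have badF: "bad (F n)" for n using F(1) by (simp add: P_def)
  have mX: "finite (m k)" "m k \<subseteq> X" for k using badF[of k] by (auto simp: m_def bad_def)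
  have mbad: "\<not> dominated r (m k) (m l)" if "k < l" for k l
  proof -
    have "\<not> dominated r (F l k) (F l l)" using badF[of l] that unfolding bad_def by blast
    then show ?thesis using that by (simp add: Fm)
  qed
  have mleast: "card (m n) \<le> card (h n)" if "bad h" "\<And>i. i < n \<Longrightarrow> h i = m i" for h n
    using F(1)[of n] that by (auto simp: P_def Fm)
  have nonempty: "m k \<noteq> {}" for k using mbad[of k "Suc k"] by (auto simp: dominated_def)
  define a where "a k = (SOME x. x \<in> m k)" for k
  have a: "a k \<in> m k" for k using nonempty unfolding a_def by (simp add: some_in_eq)
  obtain \<phi> :: "nat \<Rightarrow> nat" where \<phi>: "strict_mono \<phi>" "\<And>k l. k < l \<Longrightarrow> r (a (\<phi> k)) (a (\<phi> l))"
    using sub[of a] a mX(2) by blast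
  \<comment> \<open>From \<open>\<phi> 0\<close> on, the members along \<open>\<phi>\<close> are
    used, each without its chosen element. Nothing changes below \<open>\<phi> 0\<close>, so
    minimality of \<open>m (\<phi> 0)\<close> applies once \<open>h\<close> is known to be
    bad.\<close>
  define h where "h i = (if i < \<phi> 0 then m i else m (\<phi> (i - \<phi> 0)) - {a (\<phi> (i - \<phi> 0))})" for i
  have "\<not> dominated r (h k) (h l)" if "k < l" for k l
  proof
    assume dom: "dominated r (h k) (h l)"
    consider "l < \<phi> 0" | "k < \<phi> 0" "\<phi> 0 \<le> l" | "\<phi> 0 \<le> k" using \<open>k < l\<close> by linarith
    then show False
    proof cases
      case 1 then show ?thesis using dom mbad[OF that] that by (simp add: h_def)
    next
      case 2
      have "\<phi> 0 \<le> \<phi> (l - \<phi> 0)" using \<phi>(1) by (simp add: strict_mono_less_eq)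
      then have "k < \<phi> (l - \<phi> 0)" using 2 by linarith
      moreover have "dominated r (m k) (m (\<phi> (l - \<phi> 0)))"
        using dom 2 by (auto simp: h_def dominated_def)
      ultimately show ?thesis using mbad by blast
    next
      case 3
      then have lt: "k - \<phi> 0 < l - \<phi> 0" using that by linarith
      \<comment> \<open>The removed element is dominated by the removed element of the later member,
        the others by domination between the reduced members.\<close>
      have "dominated r (m (\<phi> (k - \<phi> 0))) (m (\<phi> (l - \<phi> 0)))"
        unfolding dominated_def
      proof
        fix x assume x: "x \<in> m (\<phi> (k - \<phi> 0))"
        show "\<exists>b\<in>m (\<phi> (l - \<phi> 0)). r x b"
        proof (cases "x = a (\<phi> (k - \<phi> 0))")
          case True then show ?thesis using \<phi>(2)[OF lt] a by blast
        next
          case False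
          then have "x \<in> h k" using x 3 by (simp add: h_def)
          then show ?thesis using dom 3 that by (auto simp: dominated_def h_def)
        qed
      qed
      moreover have "\<phi> (k - \<phi> 0) < \<phi> (l - \<phi> 0)" using \<phi>(1) lt by (simp add: strict_mono_less)
      ultimately show ?thesis using mbad by blast
    qed
  qed
  moreover have "finite (h k)" "h k \<subseteq> X" for k using mX by (auto simp: h_def)
  ultimately have "bad h" unfolding bad_def by blast
  then have "card (m (\<phi> 0)) \<le> card (h (\<phi> 0))" by (rule mleast) (auto simp only: h_def if_True)
  moreover have "card (h (\<phi> 0)) < card (m (\<phi> 0))"
    using card_Diff1_less[OF mX(1) a[of "\<phi> 0"]] by (simp only: h_def) simp
  ultimately show False by simp
qed

section \<open>Dickson's lemma and tuples of down-sets\<close>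

lemma mono_subsequence_nat:
  fixes f :: "nat \<Rightarrow> nat"
  shows "\<exists>\<phi> :: nat \<Rightarrow> nat. strict_mono \<phi> \<and> (\<forall>k l. k \<le> l \<longrightarrow> f (\<phi> k) \<le> f (\<phi> l))"
proof -
  obtain g where g: "strict_mono g" "monoseq (\<lambda>n. f (g n))" using seq_monosub by blast
  show ?thesis
  proof (cases "\<forall>m n. m \<le> n \<longrightarrow> f (g m) \<le> f (g n)")
    case True then show ?thesis using g(1) by (intro exI[of _ g]) simp
  next
    case False
    then have dec: "f (g n) \<le> f (g m)" if "m \<le> n" for m n using g(2) that by (auto simp: monoseq_def)
    \<comment> \<open>A non-increasing sequence of natural numbers is constant from the index on at
      which it attains its least value.\<close>
    define N where "N = (LEAST v. \<exists>n. f (g n) = v)"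
    have "\<exists>n. f (g n) = N" unfolding N_def by (rule LeastI_ex) blast
    then obtain n where n: "f (g n) = N" by blast
    have "f (g (n + k)) = N" for k
    proof (rule antisym)
      show "f (g (n + k)) \<le> N" using dec[of n "n + k"] n by simp
      show "N \<le> f (g (n + k))" unfolding N_def by (rule Least_le) blast
    qed
    then show ?thesis
      using g(1) by (intro exI[of _ "\<lambda>k. g (n + k)"]) (auto simp: strict_mono_def)
  qed
qed

text \<open>Dickson's lemma, one coordinate at a time: a coordinate that is already monotone stays
  so on every further subsequence.\<close>

lemma mono_subsequence_nat_vector:
  fixes f :: "nat \<Rightarrow> 'j::finite \<Rightarrow> nat"
  shows "\<exists>\<phi> :: nat \<Rightarrow> nat. strict_mono \<phi> \<and> (\<forall>k l. k \<le> l \<longrightarrow> (\<forall>j. f (\<phi> k) j \<le> f (\<phi> l) j))"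
proof -
  have "\<exists>\<phi> :: nat \<Rightarrow> nat. strict_mono \<phi> \<and> (\<forall>k l. k \<le> l \<longrightarrow> (\<forall>j\<in>J. f (\<phi> k) j \<le> f (\<phi> l) j))" if "finite J" for J
    using that
  proof induction
    case empty then show ?case by (intro exI[of _ id]) (auto simp: strict_mono_def)
  next
    case (insert j J)
    then obtain \<phi> :: "nat \<Rightarrow> nat" where \<phi>: "strict_mono \<phi>" "\<And>k l i. k \<le> l \<Longrightarrow> i \<in> J \<Longrightarrow> f (\<phi> k) i \<le> f (\<phi> l) i" by blast
    obtain \<psi> :: "nat \<Rightarrow> nat" where \<psi>: "strict_mono \<psi>" "\<And>k l. k \<le> l \<Longrightarrow> f (\<phi> (\<psi> k)) j \<le> f (\<phi> (\<psi> l)) j"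
      using mono_subsequence_nat[of "\<lambda>k. f (\<phi> k) j"] by blast
    have "strict_mono (\<lambda>k. \<phi> (\<psi> k))" using \<phi>(1) \<psi>(1) by (simp add: strict_mono_def)
    moreover have "\<psi> k \<le> \<psi> l" if "k \<le> l" for k l using \<psi>(1) that by (simp add: strict_mono_less_eq)
    ultimately show ?case using \<phi>(2) \<psi>(2) by (intro exI[of _ "\<lambda>k. \<phi> (\<psi> k)"]) auto
  qed
  from this[of UNIV] show ?thesis by simp
qed

text \<open>A tuple is encoded as one finite set, the disjoint union of its members, whose elements
  are comparable only within the same component. For down-sets, domination in this order is
  inclusion in every component.\<close>

lemma tuples_of_finite_downsets_good_pair:
  fixes D :: "nat \<Rightarrow> 'i::finite \<Rightarrow> ('j::finite \<Rightarrow> nat) set"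
  assumes fin: "\<And>k i. finite (D k i)"
    and down: "\<And>k i x y. x \<in> D k i \<Longrightarrow> (\<And>j. y j \<le> x j) \<Longrightarrow> y \<in> D k i"
  shows "\<exists>k l. k < l \<and> (\<forall>i. D k i \<subseteq> D l i)"
proof -
  define r :: "'i \<times> ('j \<Rightarrow> nat) \<Rightarrow> 'i \<times> ('j \<Rightarrow> nat) \<Rightarrow> bool"
    where "r p q \<longleftrightarrow> fst p = fst q \<and> (\<forall>j. snd p j \<le> snd q j)" for p q
  have "\<exists>k l. k < l \<and> dominated r (Sigma UNIV (D k)) (Sigma UNIV (D l))"
  proof (rule dominated_good_pair[where X = UNIV])
    fix f :: "nat \<Rightarrow> 'i \<times> ('j \<Rightarrow> nat)"
    \<comment> \<open>Infinitely many elements share a component, and within it Dickson's lemma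
      applies.\<close>
    obtain i where "infinite {k. fst (f k) = i}"
      using pigeonhole_infinite[of UNIV "\<lambda>k. fst (f k)"] finite[of "range (\<lambda>k. fst (f k))"] by auto
    then obtain g :: "nat \<Rightarrow> nat" where g: "strict_mono g" "\<And>k. fst (f (g k)) = i"
      using infinite_enumerate by blast
    obtain \<psi> :: "nat \<Rightarrow> nat" where \<psi>: "strict_mono \<psi>" "\<And>k l j. k \<le> l \<Longrightarrow> snd (f (g (\<psi> k))) j \<le> snd (f (g (\<psi> l))) j"
      using mono_subsequence_nat_vector[of "\<lambda>k. snd (f (g k))"] by blast
    show "\<exists>\<phi> :: nat \<Rightarrow> nat. strict_mono \<phi> \<and> (\<forall>k l. k < l \<longrightarrow> r (f (\<phi> k)) (f (\<phi> l)))"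
      using g \<psi> by (intro exI[of _ "g \<circ> \<psi>"]) (auto simp: r_def strict_mono_o)
  qed (use fin in auto)
  then obtain k l where "k < l" and dom: "dominated r (Sigma UNIV (D k)) (Sigma UNIV (D l))" by blast
  moreover have "x \<in> D l i" if x: "x \<in> D k i" for i x
  proof -
    obtain y where "y \<in> D l i" "\<And>j. x j \<le> y j"
      using dom x unfolding dominated_def r_def by fastforce
    then show ?thesis using down by blast
  qed
  ultimately show ?thesis by blast
qed

section \<open>Change of variables over an arbitrary finite index type\<close>

text \<open>The library states the change of variables formula only for index types of class
  \<^class>\<open>wellorder\<close>; it is transferred to an arbitrary finite index type along a bijection.\<close>

typedef ('a::finite) ordered_copy = "{..<CARD('a)}"
  by (intro exI[of _ 0]) (simp add: zero_less_card_finite)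

instance ordered_copy :: (finite) finite
proof
  have "(UNIV :: 'a ordered_copy set) = Abs_ordered_copy ` {..<CARD('a)}"
    by (rule type_definition.univ[OF type_definition_ordered_copy])
  then show "finite (UNIV :: 'a ordered_copy set)" by (metis finite_imageI finite_lessThan)
qed

instantiation ordered_copy :: (finite) wellorder
begin

definition less_eq_ordered_copy :: "'a ordered_copy \<Rightarrow> 'a ordered_copy \<Rightarrow> bool" where
  "less_eq_ordered_copy x y \<longleftrightarrow> Rep_ordered_copy x \<le> Rep_ordered_copy y"

definition less_ordered_copy :: "'a ordered_copy \<Rightarrow> 'a ordered_copy \<Rightarrow> bool" where
  "less_ordered_copy x y \<longleftrightarrow> Rep_ordered_copy x < Rep_ordered_copy y"

instance
proof
  fix P :: "'a ordered_copy \<Rightarrow> bool" and a :: "'a ordered_copy"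
  assume step: "\<And>x. (\<And>y. y < x \<Longrightarrow> P y) \<Longrightarrow> P x"
  show "P a"
    by (induction a rule: measure_induct_rule[of Rep_ordered_copy])
      (auto intro: step simp: less_ordered_copy_def)
qed (auto simp: less_eq_ordered_copy_def less_ordered_copy_def Rep_ordered_copy_inject)

end

lemma ex_bij_ordered_copy: "\<exists>f :: 'a::finite ordered_copy \<Rightarrow> 'a. bij f"
proof -
  have "card (UNIV :: 'a ordered_copy set) = CARD('a)"
    using type_definition.card[OF type_definition_ordered_copy[where 'a = 'a]] by simp
  then show ?thesis using finite_same_card_bij[of "UNIV :: 'a ordered_copy set" "UNIV :: 'a set"] by simp
qed

section \<open>Determinants and Lebesgue measure under relabelling of coordinates\<close>

lemma det_reindex:
  fixes A :: "'a::comm_ring_1^'n^'n" and \<pi> :: "'m::finite \<Rightarrow> 'n"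
  assumes "bij \<pi>"
  shows "det (\<chi> i j. A $ \<pi> i $ \<pi> j) = det A"
proof -
  have inj: "inj \<pi>" and bb: "bij_betw \<pi> UNIV UNIV" using assms by (auto simp: bij_is_inj)
  have app: "map_permutation UNIV \<pi> p (\<pi> i) = \<pi> (p i)" for p i
    by (rule map_permutation_apply) (use inj in auto)
  show ?thesis
    unfolding det_def
  \<comment> \<open>Conjugation with \<open>\<pi>\<close> carries the permutations of one index type
    bijectively to those of the other, preserves signs and matches the Leibniz terms.\<close>
  proof (rule sum.reindex_bij_witness[where j = "map_permutation UNIV \<pi>" and i = "map_permutation UNIV (inv \<pi>)"])
    fix p :: "'m \<Rightarrow> 'm" assume "p \<in> {p. p permutes UNIV}"
    then have p: "p permutes UNIV" by simp
    show "map_permutation UNIV (inv \<pi>) (map_permutation UNIV \<pi> p) = p"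
      by (rule map_permutation_compose_inv[OF bb p]) (use inj in auto)
    show "map_permutation UNIV \<pi> p \<in> {p. p permutes UNIV}"
      using map_permutation_permutes[OF bb p] by simp
    have "(\<Prod>i\<in>UNIV. A $ \<pi> i $ \<pi> (p i)) = (\<Prod>i\<in>UNIV. A $ i $ map_permutation UNIV \<pi> p i)"
      by (rule prod.reindex_bij_witness[where j = \<pi> and i = "inv \<pi>"])
        (use assms in \<open>auto simp: app bij_is_surj surj_f_inv_f bij_is_inj\<close>)
    then show "of_int (sign (map_permutation UNIV \<pi> p)) * (\<Prod>i\<in>UNIV. A $ i $ map_permutation UNIV \<pi> p i) =
      of_int (sign p) * (\<Prod>i\<in>UNIV. (\<chi> i j. A $ \<pi> i $ \<pi> j) $ i $ p i)"
      by (simp add: sign_map_permutation[OF inj p])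
  next
    fix q :: "'n \<Rightarrow> 'n" assume "q \<in> {p. p permutes UNIV}"
    then have q: "q permutes UNIV" by simp
    have bi: "bij_betw (inv \<pi>) UNIV UNIV" using assms bij_imp_bij_inv by blast
    show "map_permutation UNIV \<pi> (map_permutation UNIV (inv \<pi>) q) = q"
      by (rule map_permutation_compose_inv[OF bi q]) (use assms in \<open>auto simp: bij_is_surj surj_f_inv_f\<close>)
    show "map_permutation UNIV (inv \<pi>) q \<in> {p. p permutes UNIV}"
      using map_permutation_permutes[OF bi q] by simp
  qed
qed

lemma linear_reindex: "linear (\<lambda>x :: real^'n. (\<chi> i. x $ \<pi> i) :: real^'m)"
  by (auto intro!: linearI simp: vec_eq_iff)

text \<open>Lebesgue measure is determined by the volumes of boxes, and relabelling coordinates only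
  permutes the side lengths of a box.\<close>

lemma lborel_distr_reindex:
  fixes \<pi> :: "'m::finite \<Rightarrow> 'n::finite"
  assumes "bij \<pi>"
  shows "distr lborel borel (\<lambda>x :: real^'n. (\<chi> i. x $ \<pi> i) :: real^'m) = lborel"
proof (rule lborel_eqI[symmetric])
  let ?f = "\<lambda>x :: real^'n. (\<chi> i. x $ \<pi> i) :: real^'m"
  have cont: "continuous_on UNIV ?f"
    using linear_continuous_on[OF linear_conv_bounded_linear[THEN iffD1, OF linear_reindex]] .
  fix l u :: "real^'m"
  assume le: "\<And>b. b \<in> Basis \<Longrightarrow> l \<bullet> b \<le> u \<bullet> b"
  have le': "l $ i \<le> u $ i" for i
    using le[of "axis i 1"] by (simp add: inner_axis axis_in_Basis_iff)
  let ?g = "\<lambda>x :: real^'m. (\<chi> i. x $ inv \<pi> i) :: real^'n"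
  have vim: "?f -` box l u = box (?g l) (?g u)"
  proof -
    have "(\<forall>i. l $ i < x $ \<pi> i \<and> x $ \<pi> i < u $ i) \<longleftrightarrow>
        (\<forall>j. l $ inv \<pi> j < x $ j \<and> x $ j < u $ inv \<pi> j)" for x :: "real^'n"
      using assms by (metis bij_inv_eq_iff)
    then show ?thesis by (auto simp: mem_box_cart)
  qed
  have "emeasure (distr lborel borel ?f) (box l u) = emeasure lborel (?f -` box l u \<inter> space lborel)"
    by (rule emeasure_distr) (auto intro: borel_measurable_continuous_onI[OF cont])
  also have "\<dots> = emeasure lborel (box (?g l) (?g u))" using vim by simp
  also have "\<dots> = (\<Prod>b\<in>Basis. (?g u - ?g l) \<bullet> b)"
    by (rule emeasure_lborel_box) (auto simp: Basis_vec_def inner_axis le')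
  also have "(\<Prod>b\<in>(Basis :: (real^'n) set). (?g u - ?g l) \<bullet> b) = (\<Prod>i\<in>UNIV. u $ inv \<pi> i - l $ inv \<pi> i)"
    by (subst prod.reindex_bij_witness[where S = Basis and T = UNIV and h = "\<lambda>i. u $ inv \<pi> i - l $ inv \<pi> i"
          and j = "axis_index" and i = "\<lambda>i. axis i 1"])
      (auto simp: Basis_vec_def axis_eq_axis inner_axis axis_index_axis)
  also have "\<dots> = (\<Prod>i\<in>UNIV. u $ i - l $ i)"
    by (rule prod.reindex_bij_witness[where j = "inv \<pi>" and i = \<pi>])
      (use assms in \<open>auto simp: bij_is_surj surj_f_inv_f bij_is_inj\<close>)
  also have "\<dots> = (\<Prod>b\<in>(Basis :: (real^'m) set). (u - l) \<bullet> b)"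
    by (subst prod.reindex_bij_witness[where S = Basis and T = UNIV and h = "\<lambda>i. u $ i - l $ i"
          and j = "axis_index" and i = "\<lambda>i. axis i 1"])
      (auto simp: Basis_vec_def axis_eq_axis inner_axis axis_index_axis)
  finally show "emeasure (distr lborel borel ?f) (box l u) = (\<Prod>b\<in>Basis. (u - l) \<bullet> b)" .
qed simp

text \<open>By Sard's theorem the points with singular derivative have a null image. On the
  remaining open set \<open>g\<close> is injective, so the change of variables formula gives the
  volume of the image, which differs from \<open>K\<close> by a null set.\<close>

lemma nn_integral_abs_det_wellorder:
  fixes g :: "real^'n::{finite,wellorder} \<Rightarrow> real^'n::_" and H :: "real^'n::_ \<Rightarrow> real^'n::_^'n::_"
  assumes der: "\<And>x. (g has_derivative (\<lambda>h. H x *v h)) (at x)"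
    and inj: "inj_on g {x. det (H x) \<noteq> 0}"
    and cont: "continuous_on UNIV (\<lambda>x. det (H x))"
    and K: "K \<in> sets borel" "bounded K" "negligible (range g - K)" "negligible (K - range g)"
  shows "(\<integral>\<^sup>+x. ennreal \<bar>det (H x)\<bar> \<partial>lborel) = emeasure lborel K"
proof -
  define S where "S = {x. det (H x) \<noteq> 0}"
  have "open S"
    unfolding S_def using open_Collect_neq[OF cont continuous_on_const] .
  then have S: "S \<in> sets lebesgue" by auto
  have "negligible (g ` (- S))"
  proof (rule baby_Sard[where f' = "\<lambda>x h. H x *v h"])
    show "rank (matrix ((*v) (H x))) < CARD('n)" if "x \<in> - S" for x
      using that det_eq_0_rank[of "H x"] by (auto simp: S_def matrix_of_matrix_vector_mul)
  qed (auto intro: has_derivative_at_withinI der)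
  then have neg: "negligible (range g - g ` S)"
    by (rule negligible_subset) auto
  have Km: "K \<in> lmeasurable"
    using K(1,2) by (auto intro: bounded_set_imp_lmeasurable)
  have "negligible (sym_diff K (g ` S))"
    by (rule negligible_subset[OF negligible_Un[OF negligible_Un[OF neg K(4)] K(3)]]) auto
  then have gS: "g ` S \<in> lmeasurable" "measure lebesgue (g ` S) = measure lebesgue K"
    using lmeasurable_negligible_symdiff[OF Km] measure_negligible_symdiff[OF Km] by blast+
  have "((\<lambda>x. \<bar>det (matrix ((*v) (H x)))\<bar>) has_integral measure lebesgue K) S"
    using has_measure_differentiable_image[OF S, of g "\<lambda>x h. H x *v h" "measure lebesgue K"] gS inj
      has_derivative_at_withinI[OF der] by (simp add: S_def)
  then have "((\<lambda>x. if x \<in> S then \<bar>det (H x)\<bar> else 0) has_integral measure lebesgue K) UNIV"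
    by (simp add: has_integral_restrict_UNIV matrix_of_matrix_vector_mul)
  then have I: "((\<lambda>x. \<bar>det (H x)\<bar>) has_integral measure lebesgue K) UNIV"
    by (rule has_integral_eq[rotated]) (simp add: S_def)
  have "(\<integral>\<^sup>+x. ennreal \<bar>det (H x)\<bar> \<partial>lborel) = ennreal (measure lebesgue K)"
    by (rule nn_integral_has_integral_lborel[OF _ _ I])
      (auto intro!: borel_measurable_continuous_onI continuous_intros cont)
  also have "\<dots> = emeasure lebesgue K"
    using Km by (simp add: emeasure_eq_measure2)
  finally show ?thesis using K(1) by simp
qed

text \<open>Conjugating \<open>g\<close> with the relabelling \<open>?f\<close> reduces this to the
  ordered index type, since relabelling preserves determinants and Lebesgue measure.
  \<open>K\<close> is taken compact so that its relabelled image is again Borel and bounded.\<close>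

lemma nn_integral_abs_det:
  fixes g :: "real^'n \<Rightarrow> real^'n" and H :: "real^'n \<Rightarrow> real^'n^'n"
  assumes der: "\<And>x. (g has_derivative (\<lambda>h. H x *v h)) (at x)"
    and inj: "inj_on g {x. det (H x) \<noteq> 0}"
    and cont: "continuous_on UNIV (\<lambda>x. det (H x))"
    and K: "compact K" "negligible (range g - K)" "negligible (K - range g)"
  shows "(\<integral>\<^sup>+x. ennreal \<bar>det (H x)\<bar> \<partial>lborel) = emeasure lborel K"
proof -
  obtain \<pi> :: "'n ordered_copy \<Rightarrow> 'n" where \<pi>: "bij \<pi>" using ex_bij_ordered_copy by blast
  let ?f = "\<lambda>x :: real^'n. (\<chi> i. x $ \<pi> i) :: real^'n ordered_copy"
  let ?b = "\<lambda>x :: real^'n ordered_copy. (\<chi> i. x $ inv \<pi> i) :: real^'n"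
  let ?H = "\<lambda>x :: real^'n ordered_copy. (\<chi> i j. H (?b x) $ \<pi> i $ \<pi> j) :: real^'n ordered_copy^'n ordered_copy"
  have lin: "bounded_linear ?f" "bounded_linear ?b"
    using linear_reindex linear_conv_bounded_linear by blast+
  have cf: "continuous_on X ?f" and cb: "continuous_on Y ?b" for X Y
    using lin linear_continuous_on by blast+
  have fb: "?f (?b x) = x" and bf: "?b (?f y) = y" for x y
    using \<pi> by (simp_all add: vec_eq_iff bij_is_inj bij_is_surj surj_f_inv_f)
  have injf: "inj ?f" by (rule inj_on_inverseI[of _ ?b]) (rule bf)
  have det: "det (?H x) = det (H (?b x))" for x
    by (rule det_reindex[OF \<pi>])
  have "(\<integral>\<^sup>+x. ennreal \<bar>det (?H x)\<bar> \<partial>lborel) = emeasure lborel (?f ` K)"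
  proof (rule nn_integral_abs_det_wellorder[where g = "\<lambda>x. ?f (g (?b x))"])
    fix x
    have "((\<lambda>x. g (?b x)) has_derivative (\<lambda>h. H (?b x) *v ?b h)) (at x)"
      using has_derivative_compose[OF bounded_linear.has_derivative[OF lin(2) has_derivative_ident] der] by simp
    then have "((\<lambda>x. ?f (g (?b x))) has_derivative (\<lambda>h. ?f (H (?b x) *v ?b h))) (at x)"
      by (rule bounded_linear.has_derivative[OF lin(1)])
    moreover have "?f (H (?b x) *v ?b h) = ?H x *v h" for h
    proof -
      have "(\<Sum>j\<in>UNIV. H (?b x) $ \<pi> i $ j * h $ inv \<pi> j) = (\<Sum>j\<in>UNIV. H (?b x) $ \<pi> i $ \<pi> j * h $ j)" for i
        by (rule sum.reindex_bij_witness[where j = "inv \<pi>" and i = \<pi>])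
          (use \<pi> in \<open>auto simp: bij_is_surj surj_f_inv_f bij_is_inj\<close>)
      then show ?thesis by (simp add: matrix_vector_mult_def)
    qed
    ultimately show "((\<lambda>x. ?f (g (?b x))) has_derivative (\<lambda>h. ?H x *v h)) (at x)" by simp
  next
    show "inj_on (\<lambda>x. ?f (g (?b x))) {x. det (?H x) \<noteq> 0}"
    proof (rule inj_onI)
      fix x y assume "x \<in> {x. det (?H x) \<noteq> 0}" "y \<in> {x. det (?H x) \<noteq> 0}"
        and "?f (g (?b x)) = ?f (g (?b y))"
      then have e: "g (?b x) = g (?b y)" and n: "det (H (?b x)) \<noteq> 0" "det (H (?b y)) \<noteq> 0"
        by (metis bf) (use \<open>x \<in> _\<close> \<open>y \<in> _\<close> det in auto)
      have "?b x = ?b y" by (rule inj_onD[OF inj e CollectI CollectI]) (fact n)+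
      then show "x = y" by (metis fb)
    qed
    show "continuous_on UNIV (\<lambda>x. det (?H x))"
      unfolding det using continuous_on_compose2[OF cont cb] by blast
    have "compact (?f ` K)" using K(1) cf compact_continuous_image by blast
    then show "?f ` K \<in> sets borel" "bounded (?f ` K)" by (auto intro: compact_imp_bounded borel_compact)
    have card: "DIM(real^'n) = DIM(real^'n ordered_copy)"
      using bij_betw_same_card[OF \<pi>] by simp
    have rng: "range (\<lambda>x. ?f (g (?b x))) = ?f ` range g"
    proof -
      have "range ?b = UNIV" by (rule surjI[of ?b ?f]) (rule bf)
      moreover have "range (\<lambda>x. ?f (g (?b x))) = ?f ` g ` range ?b" by (simp only: image_image)
      ultimately show ?thesis by (simp only:)
    qed
    have diff: "?f differentiable_on X" for X
      using lin(1) bounded_linear_imp_differentiable_on by blast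
    show "negligible (range (\<lambda>x. ?f (g (?b x))) - ?f ` K)" "negligible (?f ` K - range (\<lambda>x. ?f (g (?b x))))"
      unfolding rng image_set_diff[OF injf, symmetric]
      by (rule negligible_differentiable_image_negligible; use K diff card in simp)+
  qed
  also have "emeasure lborel (?f ` K) = emeasure (distr lborel borel ?f) (?f ` K)"
    by (simp add: lborel_distr_reindex[OF \<pi>])
  also have "\<dots> = emeasure lborel (?f -` (?f ` K) \<inter> space lborel)"
  proof (rule emeasure_distr)
    show "?f ` K \<in> sets borel" using K(1) cf compact_continuous_image borel_compact by blast
  qed (auto intro: borel_measurable_continuous_onI cf)
  also have "?f -` (?f ` K) \<inter> space lborel = K"
    by (simp add: inj_vimage_image_eq[OF injf])
  also have "(\<integral>\<^sup>+x. ennreal \<bar>det (?H x)\<bar> \<partial>lborel) = (\<integral>\<^sup>+x. ennreal \<bar>det (H (?b x))\<bar> \<partial>distr lborel borel ?f)"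
    by (simp add: lborel_distr_reindex[OF \<pi>] det)
  also have "\<dots> = (\<integral>\<^sup>+x. ennreal \<bar>det (H (?b (?f x)))\<bar> \<partial>lborel)"
  proof (rule nn_integral_distr)
    have "continuous_on UNIV (\<lambda>x. det (H (?b x)))"
      using continuous_on_compose2[OF cont cb] by blast
    then show "(\<lambda>x. ennreal \<bar>det (H (?b x))\<bar>) \<in> borel_measurable (distr lborel borel ?f)"
      by (auto intro!: borel_measurable_continuous_onI continuous_intros)
  qed (auto intro: borel_measurable_continuous_onI cf)
  finally show ?thesis unfolding bf by simp
qed

section \<open>Volume as the integral of a Hessian determinant\<close>

text \<open>Along the segment from \<open>x\<close> to \<open>y\<close> the component of
  \<open>G\<close> in direction \<open>d = y - x\<close> is nondecreasing. If it agrees at both ends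
  it is constant, so its derivative at \<open>x\<close> vanishes, which puts \<open>d\<close> into
  the kernel of the nonsingular matrix \<open>H x\<close>.\<close>

lemma gradient_inj_on_nondegenerate:
  fixes G :: "real^'n \<Rightarrow> real^'n" and H :: "real^'n \<Rightarrow> real^'n^'n"
  assumes dG: "\<And>x. (G has_derivative (\<lambda>h. H x *v h)) (at x)"
    and psd: "\<And>x h. 0 \<le> h \<bullet> (H x *v h)"
    and ker: "\<And>x h. h \<bullet> (H x *v h) = 0 \<Longrightarrow> H x *v h = 0"
  shows "inj_on G {x. det (H x) \<noteq> 0}"
proof (rule inj_onI)
  fix x y assume "x \<in> {x. det (H x) \<noteq> 0}" and eq: "G x = G y"
  define d where "d = y - x"
  define \<phi> where "\<phi> t = G (x + t *\<^sub>R d) \<bullet> d" for t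
  have der: "DERIV \<phi> t :> d \<bullet> (H (x + t *\<^sub>R d) *v d)" for t
  proof -
    have "((\<lambda>t. G (x + t *\<^sub>R d)) has_derivative (\<lambda>s. H (x + t *\<^sub>R d) *v (s *\<^sub>R d))) (at t)"
      by (rule has_derivative_compose[OF _ dG]) (auto intro!: derivative_eq_intros)
    then have "(\<phi> has_derivative (\<lambda>s. (H (x + t *\<^sub>R d) *v (s *\<^sub>R d)) \<bullet> d)) (at t)"
      unfolding \<phi>_def by (rule has_derivative_inner_left)
    then show ?thesis
      by (simp add: has_field_derivative_def matrix_vector_mult_scaleR inner_commute mult_commute_abs)
  qed
  have mono: "\<phi> s \<le> \<phi> t" if "s \<le> t" for s t
    using that by (rule DERIV_nonneg_imp_nondecreasing) (use der psd in blast)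
  have const: "\<phi> t = \<phi> 0" if "0 \<le> t" "t \<le> 1" for t
    using mono[of 0 t] mono[of t 1] that eq by (simp add: \<phi>_def d_def)
  have "d \<bullet> (H x *v d) = 0"
  proof (rule ccontr)
    assume "d \<bullet> (H x *v d) \<noteq> 0"
    then have "d \<bullet> (H x *v d) > 0" using psd[of d x] by simp
    then obtain e where e: "0 < e" "\<And>h. 0 < h \<Longrightarrow> h < e \<Longrightarrow> \<phi> 0 < \<phi> (0 + h)"
      using DERIV_pos_inc_right[OF der[of 0]] by auto
    have "0 < min (e/2) 1" "min (e/2) 1 < e" "min (e/2) 1 \<le> 1" using e(1) by auto
    then show False using e(2)[of "min (e/2) 1"] const[of "min (e/2) 1"] by simp
  qed
  then have "H x *v d = 0" by (rule ker)
  moreover have "inj ((*v) (H x))"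
    using \<open>x \<in> _\<close> by (intro inj_matrix_vector_mult) (simp add: invertible_det_nz)
  ultimately have "d = 0" by (metis injD matrix_vector_mult_0_right)
  then show "x = y" by (simp add: d_def)
qed

text \<open>For \<open>y\<close> in the interior of \<open>K\<close>, the function
  \<open>F x - y \<bullet> x\<close> is coercive and hence has a minimum; there the gradient of
  \<open>F\<close> equals \<open>y\<close>.\<close>

lemma interior_subset_range_gradient:
  fixes F :: "real^'n \<Rightarrow> real" and G :: "real^'n \<Rightarrow> real^'n"
  assumes dF: "\<And>x. (F has_derivative (\<lambda>h. G x \<bullet> h)) (at x)"
    and lower: "\<And>k x. k \<in> K \<Longrightarrow> k \<bullet> x \<le> F x + c"
  shows "interior K \<subseteq> range G"
proof
  fix y assume "y \<in> interior K"
  then obtain r where r: "r > 0" "cball y r \<subseteq> K" by (meson mem_interior_cball)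
  define \<phi> where "\<phi> x = F x - y \<bullet> x" for x
  have coercive: "\<phi> x \<ge> r * norm x - c" for x
  proof (cases "x = 0")
    case True
    have "y \<in> K" using r by (intro subsetD[OF r(2)]) simp
    then show ?thesis using lower[of y x] True by (simp add: \<phi>_def)
  next
    case False
    \<comment> \<open>Moving from \<open>y\<close> by \<open>r\<close> in the direction of
      \<open>x\<close> stays in \<open>K\<close> and gains \<open>r * norm x\<close> in the lower
      bound.\<close>
    have "y + (r / norm x) *\<^sub>R x \<in> K"
      using r False by (intro subsetD[OF r(2)]) (simp add: dist_norm)
    from lower[OF this, of x] show ?thesis
      using False by (simp add: \<phi>_def inner_add_left dot_square_norm power2_eq_square)
  qed
  \<comment> \<open>Outside the ball of radius \<open>R\<close> coercivity gives at least the value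
    \<open>\<phi> 0\<close>, so a minimum over the ball is global.\<close>
  define R where "R = (\<phi> 0 + c) / r"
  have R: "r * R = \<phi> 0 + c" "R \<ge> 0"
    using r coercive[of 0] by (auto simp: R_def)
  have d\<phi>: "(\<phi> has_derivative (\<lambda>h. G x \<bullet> h - y \<bullet> h)) (at x)" for x
    unfolding \<phi>_def by (rule derivative_eq_intros dF refl)+ simp
  have cont: "continuous_on (cball 0 R) \<phi>"
    by (meson d\<phi> continuous_at_imp_continuous_on has_derivative_continuous)
  obtain x where x: "x \<in> cball 0 R" "\<And>z. z \<in> cball 0 R \<Longrightarrow> \<phi> x \<le> \<phi> z"
    using continuous_attains_inf[OF compact_cball _ cont] R(2) by auto
  have "\<phi> x \<le> \<phi> z" for z
  proof (cases "norm z \<le> R")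
    case True then show ?thesis using x(2) by simp
  next
    case False
    then have "r * R \<le> r * norm z" using r by simp
    then show ?thesis using coercive[of z] R x(2)[of 0] by simp
  qed
  then have "(\<lambda>h. G x \<bullet> h - y \<bullet> h) = (\<lambda>h. 0)"
    using differential_zero_maxmin[of x UNIV \<phi> "\<lambda>h. G x \<bullet> h - y \<bullet> h"] d\<phi> by auto
  then have "(G x - y) \<bullet> (G x - y) = 0"
    by (metis inner_diff_left)
  then show "y \<in> range G" by (metis eq_iff_diff_eq_0 inner_eq_zero_iff rangeI)
qed

text \<open>The gradient maps into \<open>K\<close>, misses at most the frontier, which is null by
  convexity, and is injective where the Hessian is nonsingular. Hypothesis \<open>lower\<close> says
  that \<open>F\<close> stays above the support function of \<open>K\<close> up to a
  constant.\<close>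

lemma nn_integral_hessian_eq_volume:
  fixes F :: "real^'n \<Rightarrow> real" and G :: "real^'n \<Rightarrow> real^'n" and H :: "real^'n \<Rightarrow> real^'n^'n"
  assumes dF: "\<And>x. (F has_derivative (\<lambda>h. G x \<bullet> h)) (at x)"
    and dG: "\<And>x. (G has_derivative (\<lambda>h. H x *v h)) (at x)"
    and psd: "\<And>x h. 0 \<le> h \<bullet> (H x *v h)"
    and ker: "\<And>x h. h \<bullet> (H x *v h) = 0 \<Longrightarrow> H x *v h = 0"
    and cont: "continuous_on UNIV (\<lambda>x. det (H x))"
    and K: "compact K" "convex K"
    and range: "\<And>x. G x \<in> K"
    and lower: "\<And>k x. k \<in> K \<Longrightarrow> k \<bullet> x \<le> F x + c"
  shows "(\<integral>\<^sup>+x. ennreal \<bar>det (H x)\<bar> \<partial>lborel) = emeasure lborel K"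
proof (rule nn_integral_abs_det[OF dG gradient_inj_on_nondegenerate[OF dG psd ker] cont K(1)])
  show "negligible (range G - K)" using range by (simp add: Diff_eq_empty_iff[THEN iffD2] image_subsetI)
  have "K - range G \<subseteq> frontier K"
    using interior_subset_range_gradient[OF dF lower] closure_subset by (auto simp: frontier_def)
  then show "negligible (K - range G)"
    using negligible_convex_frontier[OF K(2)] negligible_subset by blast
qed

section \<open>Nonnegativity of mixed discriminants\<close>

lemma finite_function_set: "finite T \<Longrightarrow> finite {\<phi> :: 'n::finite \<Rightarrow> 'k. \<forall>i. \<phi> i \<in> T}"
  using finite_PiE[of UNIV "\<lambda>_ :: 'n. T"] by (simp add: PiE_def Pi_def)

lemma det_rows_sum_PiE:
  fixes a :: "'n \<Rightarrow> 'k \<Rightarrow> 'a::comm_ring_1^'n"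
  assumes "finite T"
  shows "det (\<chi> i. \<Sum>k\<in>T. a i k) = (\<Sum>\<phi> | \<forall>i. \<phi> i \<in> T. det (\<chi> i. a i (\<phi> i)))"
proof -
  have "(\<Prod>i\<in>UNIV. \<Sum>k\<in>T. a i k $ p i) = (\<Sum>\<phi> | \<forall>i. \<phi> i \<in> T. \<Prod>i\<in>UNIV. a i (\<phi> i) $ p i)" for p
    using prod_sum_PiE[of UNIV "\<lambda>_. T" "\<lambda>i k. a i k $ p i"] assms by (simp add: PiE_def Pi_def)
  then have "det (\<chi> i. \<Sum>k\<in>T. a i k) =
      (\<Sum>p | p permutes UNIV. \<Sum>\<phi> | \<forall>i. \<phi> i \<in> T. of_int (sign p) * (\<Prod>i\<in>UNIV. a i (\<phi> i) $ p i))"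
    by (simp add: det_def sum_component sum_distrib_left)
  then show ?thesis by (subst (asm) sum.swap) (simp add: det_def)
qed

text \<open>Row \<open>i\<close> of the matrix is the combination of the vectors \<open>v k\<close>
  with coefficients \<open>w k * v k $ i\<close>; the formula is the expansion by multilinearity in
  the rows.\<close>

lemma det_sum_outer_products:
  fixes v :: "'k \<Rightarrow> real^'n" and w :: "'k \<Rightarrow> real"
  assumes "finite T"
  shows "det (\<chi> i j. \<Sum>k\<in>T. w k * v k $ i * v k $ j) =
    (\<Sum>\<phi> | \<forall>i. \<phi> i \<in> T. (\<Prod>i\<in>UNIV. w (\<phi> i) * v (\<phi> i) $ i) * det (\<chi> i. v (\<phi> i)))"
proof -
  have "(\<chi> i j. \<Sum>k\<in>T. w k * v k $ i * v k $ j) = (\<chi> i. \<Sum>k\<in>T. (w k * v k $ i) *s v k)"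
    by (simp add: vec_eq_iff sum_component)
  then show ?thesis
    using det_rows_sum_PiE[OF assms, of "\<lambda>i k. (w k * v k $ i) *s v k"] by (simp add: det_rows_mul)
qed

text \<open>Summing over all permutations of the indices turns each summand into a nonnegative weight
  times a squared determinant.\<close>

lemma sum_outer_products_symmetrised_nonneg:
  fixes v :: "'k \<Rightarrow> real^'n" and w :: "'k \<Rightarrow> real"
  assumes fin: "finite \<F>"
    and perm: "\<And>\<phi> \<tau>. \<phi> \<in> \<F> \<Longrightarrow> \<tau> permutes UNIV \<Longrightarrow> \<phi> \<circ> \<tau> \<in> \<F>"
    and w: "\<And>\<phi> i. \<phi> \<in> \<F> \<Longrightarrow> w (\<phi> i) \<ge> 0"
  shows "0 \<le> (\<Sum>\<phi>\<in>\<F>. (\<Prod>i\<in>UNIV. w (\<phi> i) * v (\<phi> i) $ i) * det (\<chi> i. v (\<phi> i)))"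
proof -
  let ?Q = "\<lambda>\<phi> :: 'n \<Rightarrow> 'k. (\<Prod>i\<in>UNIV. w (\<phi> i) * v (\<phi> i) $ i) * det (\<chi> i. v (\<phi> i))"
  let ?P = "{\<tau> :: 'n \<Rightarrow> 'n. \<tau> permutes UNIV}"
  \<comment> \<open>The family \<open>\<F>\<close> is invariant under permuting the arguments, so
    each \<open>\<tau>\<close> only rearranges the sum, and averaging over all \<open>\<tau>\<close>
    does not change it.\<close>
  have shift: "(\<Sum>\<phi>\<in>\<F>. ?Q (\<phi> \<circ> \<tau>)) = (\<Sum>\<phi>\<in>\<F>. ?Q \<phi>)" if "\<tau> \<in> ?P" for \<tau>
  proof (rule sum.reindex_bij_witness[where j = "\<lambda>\<phi>. \<phi> \<circ> \<tau>" and i = "\<lambda>\<phi>. \<phi> \<circ> inv \<tau>"])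
    fix \<phi> assume "\<phi> \<in> \<F>"
    have \<tau>: "\<tau> permutes UNIV" using that by simp
    show "\<phi> \<circ> \<tau> \<circ> inv \<tau> = \<phi>" "\<phi> \<circ> inv \<tau> \<circ> \<tau> = \<phi>"
      using permutes_inv_o[OF \<tau>] by (simp_all add: o_assoc[symmetric])
    show "\<phi> \<circ> \<tau> \<in> \<F>" "\<phi> \<circ> inv \<tau> \<in> \<F>"
      using perm \<open>\<phi> \<in> \<F>\<close> \<tau> permutes_inv by blast+
  qed simp
  \<comment> \<open>For fixed \<open>\<phi>\<close>, permuting the rows changes the determinant by
    the sign of \<open>\<tau>\<close> only; the signed products then add up to a second copy of the
    determinant by Leibniz's formula.\<close>
  have square: "(\<Sum>\<tau>\<in>?P. ?Q (\<phi> \<circ> \<tau>)) = (\<Prod>i\<in>UNIV. w (\<phi> i)) * (det (\<chi> i. v (\<phi> i)))\<^sup>2" for \<phi>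
  proof -
    let ?M = "(\<chi> i. v (\<phi> i)) :: real^'n^'n"
    have "?Q (\<phi> \<circ> \<tau>) = (\<Prod>i\<in>UNIV. w (\<phi> i)) * det ?M *
        (of_int (sign \<tau>) * (\<Prod>i\<in>UNIV. transpose ?M $ i $ \<tau> i))" if "\<tau> \<in> ?P" for \<tau>
    proof -
      have \<tau>: "\<tau> permutes UNIV" using that by simp
      have "(\<Prod>i\<in>UNIV. w (\<phi> (\<tau> i))) = (\<Prod>i\<in>UNIV. w (\<phi> i))"
        using prod.permute[OF \<tau>, of "\<lambda>i. w (\<phi> i)"] by (simp add: o_def)
      moreover have "det (\<chi> i. v (\<phi> (\<tau> i))) = of_int (sign \<tau>) * det ?M"
        using det_permute_rows[OF \<tau>, of ?M] by simp
      ultimately show ?thesis by (simp add: prod.distrib transpose_def)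
    qed
    then have "(\<Sum>\<tau>\<in>?P. ?Q (\<phi> \<circ> \<tau>)) = (\<Sum>\<tau>\<in>?P. (\<Prod>i\<in>UNIV. w (\<phi> i)) * det ?M *
        (of_int (sign \<tau>) * (\<Prod>i\<in>UNIV. transpose ?M $ i $ \<tau> i)))"
      by (rule sum.cong[OF refl])
    also have "\<dots> = (\<Prod>i\<in>UNIV. w (\<phi> i)) * det ?M * det (transpose ?M)"
      unfolding det_def[of "transpose ?M"] sum_distrib_left ..
    finally have "(\<Sum>\<tau>\<in>?P. ?Q (\<phi> \<circ> \<tau>)) = (\<Prod>i\<in>UNIV. w (\<phi> i)) * det ?M * det (transpose ?M)" .
    then show ?thesis by (simp add: det_transpose power2_eq_square)
  qed
  have "real (card ?P) * (\<Sum>\<phi>\<in>\<F>. ?Q \<phi>) = (\<Sum>\<tau>\<in>?P. \<Sum>\<phi>\<in>\<F>. ?Q (\<phi> \<circ> \<tau>))"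
    using sum.cong[OF refl shift, of ?P "\<lambda>x. x"] by simp
  also have "\<dots> = (\<Sum>\<phi>\<in>\<F>. \<Sum>\<tau>\<in>?P. ?Q (\<phi> \<circ> \<tau>))" by (rule sum.swap)
  also have "\<dots> \<ge> 0"
    unfolding square by (intro sum_nonneg mult_nonneg_nonneg prod_nonneg w) auto
  finally have "0 \<le> real (card ?P) * (\<Sum>\<phi>\<in>\<F>. ?Q \<phi>)" .
  moreover have "real (card ?P) > 0" by (simp add: card_permutations)
  ultimately show ?thesis using mult_le_cancel_left_pos[of "real (card ?P)" 0] by (simp only: mult_zero_right)
qed

lemma det_sum_outer_products_nonneg:
  fixes v :: "'k \<Rightarrow> real^'n" and w :: "'k \<Rightarrow> real"
  assumes "finite T" and "\<And>k. k \<in> T \<Longrightarrow> w k \<ge> 0"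
  shows "0 \<le> det (\<chi> i j. \<Sum>k\<in>T. w k * v k $ i * v k $ j)"
  unfolding det_sum_outer_products[OF assms(1)]
  by (rule sum_outer_products_symmetrised_nonneg) (use assms finite_function_set in auto)

text \<open>Each determinant expands into terms indexed by a choice, for every row, of a matrix
  index and a vector belonging to it. The alternating sum is a Moebius inversion that keeps the
  choices in which every matrix index occurs. This family is invariant under permutations, so the
  symmetrisation argument applies.\<close>

lemma mixed_discriminant_nonneg:
  fixes v :: "'n::finite \<Rightarrow> 'a \<Rightarrow> real^'n" and w :: "'n \<Rightarrow> 'a \<Rightarrow> real"
  assumes fin: "\<And>k. finite (S k)" and w: "\<And>k a. a \<in> S k \<Longrightarrow> w k a \<ge> 0"
  shows "0 \<le> (\<Sum>I\<in>Pow UNIV. (-1) ^ (CARD('n) - card I) *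
    det (\<Sum>k\<in>I. \<chi> i j. \<Sum>a\<in>S k. w k a * v k a $ i * v k a $ j))"
proof -
  let ?w = "\<lambda>p. w (fst p) (snd p)" and ?v = "\<lambda>p. v (fst p) (snd p)"
  let ?Q = "\<lambda>\<phi> :: 'n \<Rightarrow> 'n \<times> 'a. (\<Prod>i\<in>UNIV. ?w (\<phi> i) * ?v (\<phi> i) $ i) * det (\<chi> i. ?v (\<phi> i))"
  define g where "g I = det (\<Sum>k\<in>I. \<chi> i j. \<Sum>a\<in>S k. w k a * v k a $ i * v k a $ j)" for I
  \<comment> \<open>Choices are grouped by the exact set \<open>R\<close> of matrix indices that
    occur in them; those contributing to \<open>g I\<close> are the ones with
    \<open>R \<subseteq> I\<close>.\<close>
  define f where "f R = (\<Sum>\<phi> | (\<forall>i. \<phi> i \<in> Sigma UNIV S) \<and> range (fst \<circ> \<phi>) = R. ?Q \<phi>)" for R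
  have finF: "finite {\<phi> :: 'n \<Rightarrow> 'n \<times> 'a. (\<forall>i. \<phi> i \<in> Sigma I S) \<and> P \<phi>}" for I P
    by (rule finite_subset[OF _ finite_function_set[of "Sigma I S"]]) (auto simp: fin)
  have "g I = sum f (Pow I)" for I
  proof -
    have "(\<Sum>k\<in>I. \<chi> i j. \<Sum>a\<in>S k. w k a * v k a $ i * v k a $ j) =
        (\<chi> i j. \<Sum>p\<in>Sigma I S. ?w p * ?v p $ i * ?v p $ j)"
      by (simp add: vec_eq_iff sum_component sum.Sigma fin split_def)
    then have "g I = (\<Sum>\<phi> | \<forall>i. \<phi> i \<in> Sigma I S. ?Q \<phi>)"
      unfolding g_def by (simp add: det_sum_outer_products fin del: mem_Sigma_iff)
    also have "\<dots> = (\<Sum>R\<in>Pow I. \<Sum>\<phi> | \<phi> \<in> {\<phi>. \<forall>i. \<phi> i \<in> Sigma I S} \<and> range (fst \<circ> \<phi>) = R. ?Q \<phi>)"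
    proof (rule sum.group[symmetric])
      have "fst (\<phi> i) \<in> I" if "\<forall>i. \<phi> i \<in> Sigma I S" for \<phi> :: "'n \<Rightarrow> 'n \<times> 'a" and i
        using that by (metis SigmaE fst_conv)
      then show "(\<lambda>\<phi>. range (fst \<circ> \<phi>)) ` {\<phi>. \<forall>i. \<phi> i \<in> Sigma I S} \<subseteq> Pow I" by auto
    qed (use finF[of I "\<lambda>_. True"] in auto)
    also have "\<dots> = sum f (Pow I)"
    proof (rule sum.cong[OF refl])
      fix R assume "R \<in> Pow I"
      moreover have "p \<in> Sigma J S \<longleftrightarrow> fst p \<in> J \<and> snd p \<in> S (fst p)" for p J by (cases p) auto
      ultimately have "{\<phi>. \<phi> \<in> {\<phi>. \<forall>i. \<phi> i \<in> Sigma I S} \<and> range (fst \<circ> \<phi>) = R} =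
          {\<phi> :: 'n \<Rightarrow> 'n \<times> 'a. (\<forall>i. \<phi> i \<in> Sigma UNIV S) \<and> range (fst \<circ> \<phi>) = R}"
        by auto
      then show "(\<Sum>\<phi> | \<phi> \<in> {\<phi>. \<forall>i. \<phi> i \<in> Sigma I S} \<and> range (fst \<circ> \<phi>) = R. ?Q \<phi>) = f R"
        unfolding f_def by (rule arg_cong)
    qed
    finally show ?thesis .
  qed
  from inclusion_exclusion_mobius[of g f, OF this] have
    "(\<Sum>I\<in>Pow UNIV. (-1) ^ (CARD('n) - card I) * g I) = f UNIV" by simp
  moreover have "0 \<le> f UNIV"
    unfolding f_def
  proof (rule sum_outer_products_symmetrised_nonneg)
    fix \<phi> :: "'n \<Rightarrow> 'n \<times> 'a" and \<tau> :: "'n \<Rightarrow> 'n"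
    assume \<phi>: "\<phi> \<in> {\<phi>. (\<forall>i. \<phi> i \<in> Sigma UNIV S) \<and> range (fst \<circ> \<phi>) = UNIV}" and "\<tau> permutes UNIV"
    then have "range \<tau> = UNIV" by (simp add: permutes_surj)
    then have "range (fst \<circ> (\<phi> \<circ> \<tau>)) = range (fst \<circ> \<phi>)" by (metis image_comp)
    then show "\<phi> \<circ> \<tau> \<in> {\<phi>. (\<forall>i. \<phi> i \<in> Sigma UNIV S) \<and> range (fst \<circ> \<phi>) = UNIV}"
      using \<phi> by simp
  next
    fix \<phi> :: "'n \<Rightarrow> 'n \<times> 'a" and i
    assume "\<phi> \<in> {\<phi>. (\<forall>i. \<phi> i \<in> Sigma UNIV S) \<and> range (fst \<circ> \<phi>) = UNIV}"
    then have "\<phi> i \<in> Sigma UNIV S" by blast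
    then show "0 \<le> w (fst (\<phi> i)) (snd (\<phi> i))" using w by (auto simp: mem_Sigma_iff split_def)
  qed (rule finF)
  ultimately show ?thesis by (simp add: g_def)
qed

section \<open>Logarithms of exponential sums\<close>

definition weighting :: "('a \<Rightarrow> real) \<Rightarrow> 'a set \<Rightarrow> bool" where
  "weighting c A \<longleftrightarrow> finite A \<and> (\<forall>a\<in>A. 0 \<le> c a) \<and> (\<exists>a\<in>A. 0 < c a)"

definition exp_sum :: "(real^'n \<Rightarrow> real) \<Rightarrow> (real^'n) set \<Rightarrow> real^'n \<Rightarrow> real" where
  "exp_sum c A x = (\<Sum>a\<in>A. c a * exp (a \<bullet> x))"

definition gibbs :: "(real^'n \<Rightarrow> real) \<Rightarrow> (real^'n) set \<Rightarrow> real^'n \<Rightarrow> real^'n \<Rightarrow> real" where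
  "gibbs c A x a = c a * exp (a \<bullet> x) / exp_sum c A x"

text \<open>For a \<open>weighting\<close>, the expectation of the Gibbs distribution on
  \<open>A\<close>, which is the gradient of \<open>ln (exp_sum c A x)\<close>.\<close>

definition gibbs_mean :: "(real^'n \<Rightarrow> real) \<Rightarrow> (real^'n) set \<Rightarrow> real^'n \<Rightarrow> real^'n" where
  "gibbs_mean c A x = (\<Sum>a\<in>A. gibbs c A x a *\<^sub>R a)"

text \<open>The Hessian matrix of \<open>ln (exp_sum c A x)\<close>.\<close>

definition gibbs_cov :: "(real^'n \<Rightarrow> real) \<Rightarrow> (real^'n) set \<Rightarrow> real^'n \<Rightarrow> real^'n^'n" where
  "gibbs_cov c A x =
    (\<chi> i j. \<Sum>a\<in>A. gibbs c A x a * (a - gibbs_mean c A x) $ i * (a - gibbs_mean c A x) $ j)"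

lemma weighting_pos: "finite A \<Longrightarrow> A \<noteq> {} \<Longrightarrow> (\<And>a. a \<in> A \<Longrightarrow> 0 < c a) \<Longrightarrow> weighting c A"
  unfolding weighting_def by (metis ex_in_conv less_imp_le)

lemma exp_sum_pos: "weighting c A \<Longrightarrow> exp_sum c A x > 0"
  unfolding exp_sum_def weighting_def by (meson exp_gt_zero less_eq_real_def mult_nonneg_nonneg mult_pos_pos sum_pos2)

lemma gibbs_nonneg: "weighting c A \<Longrightarrow> a \<in> A \<Longrightarrow> 0 \<le> gibbs c A x a"
  using exp_sum_pos[of c A x] by (auto simp: gibbs_def weighting_def)

lemma sum_gibbs: "weighting c A \<Longrightarrow> (\<Sum>a\<in>A. gibbs c A x a) = 1"
  using exp_sum_pos[of c A x] unfolding gibbs_def by (simp add: sum_divide_distrib[symmetric] exp_sum_def)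

lemma sum_gibbs_centered:
  assumes "weighting c A"
  shows "(\<Sum>a\<in>A. gibbs c A x a * ((a - gibbs_mean c A x) \<bullet> h)) = 0"
proof -
  have "(\<Sum>a\<in>A. gibbs c A x a * (a \<bullet> h)) = gibbs_mean c A x \<bullet> h"
    by (simp add: gibbs_mean_def inner_sum_left)
  then show ?thesis
    using sum_gibbs[OF assms, of x]
    by (simp add: inner_diff_left right_diff_distrib sum_subtractf sum_distrib_right[symmetric])
qed

lemma gibbs_mean_in_hull: "weighting c A \<Longrightarrow> gibbs_mean c A x \<in> convex hull A"
  unfolding gibbs_mean_def
  by (rule convex_sum) (auto simp: sum_gibbs gibbs_nonneg hull_inc weighting_def)

section \<open>Gradient and Hessian of the logarithm of an exponential sum\<close>

lemma exp_sum_has_derivative: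
  assumes "weighting c A"
  shows "(exp_sum c A has_derivative (\<lambda>h. exp_sum c A x * (gibbs_mean c A x \<bullet> h))) (at x)"
proof -
  have "(exp_sum c A has_derivative (\<lambda>h. \<Sum>a\<in>A. c a * (exp (a \<bullet> x) * (a \<bullet> h)))) (at x)"
    unfolding exp_sum_def by (auto intro!: derivative_eq_intros simp: mult_ac)
  moreover have "c a * (exp (a \<bullet> x) * (a \<bullet> h)) = exp_sum c A x * (gibbs c A x a * (a \<bullet> h))" for a h
    using exp_sum_pos[OF assms, of x] by (simp add: gibbs_def)
  ultimately show ?thesis
    by (simp add: gibbs_mean_def inner_sum_left sum_distrib_left)
qed

lemma ln_exp_sum_has_derivative:
  assumes "weighting c A"
  shows "((\<lambda>x. ln (exp_sum c A x)) has_derivative (\<lambda>h. gibbs_mean c A x \<bullet> h)) (at x)"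
proof -
  have "exp_sum c A x \<noteq> 0" using exp_sum_pos[OF assms, of x] by simp
  then have "exp_sum c A x * (gibbs_mean c A x \<bullet> h) * inverse (exp_sum c A x) = gibbs_mean c A x \<bullet> h" for h
    by (simp add: field_simps)
  then show ?thesis
    using has_derivative_ln[OF exp_sum_pos[OF assms] exp_sum_has_derivative[OF assms], of x] by (simp only:)
qed

lemma gibbs_has_derivative:
  assumes "weighting c A"
  shows "((\<lambda>x. gibbs c A x a) has_derivative (\<lambda>h. gibbs c A x a * ((a - gibbs_mean c A x) \<bullet> h))) (at x)"
proof -
  have "((\<lambda>x. c a * exp (a \<bullet> x)) has_derivative (\<lambda>h. c a * (exp (a \<bullet> x) * (a \<bullet> h)))) (at x)"
    by (auto intro!: derivative_eq_intros)
  note quotient = has_derivative_divide'[OF this exp_sum_has_derivative[OF assms]]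
  have nz: "exp_sum c A x \<noteq> 0" using exp_sum_pos[OF assms, of x] by simp
  have "(c a * (exp (a \<bullet> x) * (a \<bullet> h)) * exp_sum c A x -
        c a * exp (a \<bullet> x) * (exp_sum c A x * (gibbs_mean c A x \<bullet> h))) / (exp_sum c A x * exp_sum c A x) =
      gibbs c A x a * ((a - gibbs_mean c A x) \<bullet> h)" for h
    using nz by (simp add: gibbs_def inner_diff_left field_simps)
  then show ?thesis
    using quotient nz by (simp add: gibbs_def[abs_def])
qed

lemma gibbs_cov_mult:
  "gibbs_cov c A x *v h =
    (\<Sum>a\<in>A. (gibbs c A x a * ((a - gibbs_mean c A x) \<bullet> h)) *\<^sub>R (a - gibbs_mean c A x))"
proof -
  have "(\<Sum>j\<in>UNIV. (\<Sum>a\<in>A. gibbs c A x a * (a - gibbs_mean c A x) $ i * (a - gibbs_mean c A x) $ j) * h $ j) =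
    (\<Sum>a\<in>A. gibbs c A x a * (\<Sum>j\<in>UNIV. (a - gibbs_mean c A x) $ j * h $ j) * (a - gibbs_mean c A x) $ i)" for i
    unfolding sum_distrib_right sum_distrib_left
    by (subst sum.swap) (intro sum.cong refl, simp)
  then show ?thesis
    by (simp add: gibbs_cov_def matrix_vector_mult_def vec_eq_iff sum_component inner_vec_def)
qed

lemma gibbs_mean_has_derivative:
  assumes "weighting c A"
  shows "(gibbs_mean c A has_derivative (\<lambda>h. gibbs_cov c A x *v h)) (at x)"
proof -
  have "(gibbs_mean c A has_derivative
      (\<lambda>h. \<Sum>a\<in>A. (gibbs c A x a * ((a - gibbs_mean c A x) \<bullet> h)) *\<^sub>R a)) (at x)"
  proof -
    have eq: "gibbs_mean c A = (\<lambda>x. \<Sum>a\<in>A. gibbs c A x a *\<^sub>R a)" by (simp add: gibbs_mean_def fun_eq_iff)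
    show ?thesis
      by (subst eq) (intro has_derivative_sum has_derivative_scaleR_left gibbs_has_derivative[OF assms])
  qed
  \<comment> \<open>The coefficients sum to zero by \<open>sum_gibbs_centered\<close>, so
    \<open>a\<close> may be replaced by its deviation from the mean.\<close>
  moreover have "(\<Sum>a\<in>A. (gibbs c A x a * ((a - gibbs_mean c A x) \<bullet> h)) *\<^sub>R a) = gibbs_cov c A x *v h" for h
    using sum_gibbs_centered[OF assms, of x h]
    by (simp add: gibbs_cov_mult scaleR_right_diff_distrib sum_subtractf scaleR_left.sum[symmetric])
  ultimately show ?thesis by simp
qed

lemma inner_gibbs_cov:
  "h \<bullet> (gibbs_cov c A x *v h) = (\<Sum>a\<in>A. gibbs c A x a * ((a - gibbs_mean c A x) \<bullet> h)\<^sup>2)"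
  by (simp add: gibbs_cov_mult inner_sum_right power2_eq_square inner_commute mult.assoc)

lemma inner_gibbs_cov_nonneg:
  assumes "weighting c A" shows "0 \<le> h \<bullet> (gibbs_cov c A x *v h)"
  unfolding inner_gibbs_cov by (intro sum_nonneg mult_nonneg_nonneg gibbs_nonneg[OF assms]) auto

text \<open>The quadratic form is a sum of nonnegative terms. If it vanishes, each term does, and
  with it each coefficient in \<open>gibbs_cov_mult\<close>.\<close>

lemma gibbs_cov_kernel:
  assumes "weighting c A" "h \<bullet> (gibbs_cov c A x *v h) = 0"
  shows "gibbs_cov c A x *v h = 0"
proof -
  have "\<forall>a\<in>A. gibbs c A x a * ((a - gibbs_mean c A x) \<bullet> h)\<^sup>2 = 0"
    using assms(2) unfolding inner_gibbs_cov
    by (subst (asm) sum_nonneg_eq_0_iff) (use assms(1) gibbs_nonneg[OF assms(1)] in \<open>auto simp: weighting_def\<close>)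
  then show ?thesis by (auto simp: gibbs_cov_mult intro!: sum.neutral)
qed

lemma continuous_on_gibbs_mean: "weighting c A \<Longrightarrow> continuous_on UNIV (gibbs_mean c A)"
  by (intro continuous_at_imp_continuous_on ballI has_derivative_continuous[OF gibbs_mean_has_derivative])

lemma continuous_on_gibbs: "weighting c A \<Longrightarrow> continuous_on UNIV (\<lambda>x. gibbs c A x a)"
  by (intro continuous_at_imp_continuous_on ballI has_derivative_continuous[OF gibbs_has_derivative])

lemma continuous_on_det_sum_gibbs_cov:
  assumes "\<And>i. i \<in> I \<Longrightarrow> weighting (c i) (A i)"
  shows "continuous_on UNIV (\<lambda>x. det (\<Sum>i\<in>I. gibbs_cov (c i) (A i) x))"
proof -
  have "continuous_on UNIV (\<lambda>x. (\<Sum>i\<in>I. gibbs_cov (c i) (A i) x) $ r $ s)" for r s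
    by (simp only: sum_component gibbs_cov_def vec_lambda_beta)
      (intro continuous_on_sum continuous_on_mult continuous_on_component continuous_on_diff
        continuous_on_const continuous_on_gibbs continuous_on_gibbs_mean assms)
  then show ?thesis unfolding det_def
    by (intro continuous_on_sum continuous_on_mult continuous_on_prod continuous_on_const)
qed

text \<open>The logarithm of the sum dominates that of each single term, whose weight costs only a
  constant. The bound is a half-space condition on \<open>k\<close>, so it passes from
  \<open>A\<close> to its convex hull.\<close>

lemma hull_inner_le_ln_exp_sum:
  assumes "finite A" "A \<noteq> {}" and pos: "\<And>a. a \<in> A \<Longrightarrow> 0 < c a"
  shows "\<exists>C. \<forall>k\<in>convex hull A. \<forall>x. k \<bullet> x \<le> ln (exp_sum c A x) + C"
proof -
  define C where "C = (\<Sum>a\<in>A. \<bar>ln (c a)\<bar>)"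
  have wt: "weighting c A" using assms by (rule weighting_pos)
  have "k \<bullet> x \<le> ln (exp_sum c A x) + C" if "k \<in> convex hull A" for k x
  proof -
    have "a \<bullet> x \<le> ln (exp_sum c A x) + C" if a: "a \<in> A" for a
    proof -
      have "c a * exp (a \<bullet> x) \<le> exp_sum c A x"
        unfolding exp_sum_def using assms a by (intro member_le_sum) (auto simp: less_imp_le)
      then have "ln (c a * exp (a \<bullet> x)) \<le> ln (exp_sum c A x)"
        using pos[OF a] exp_sum_pos[OF wt, of x] by (subst ln_le_cancel_iff) auto
      moreover have "ln (c a * exp (a \<bullet> x)) = ln (c a) + a \<bullet> x"
        using pos[OF a] by (simp add: ln_mult)
      moreover have "\<bar>ln (c a)\<bar> \<le> C" unfolding C_def using assms(1) a by (intro member_le_sum) auto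
      ultimately show ?thesis by linarith
    qed
    then have "A \<subseteq> {y. x \<bullet> y \<le> ln (exp_sum c A x) + C}" by (auto simp: inner_commute)
    then have "convex hull A \<subseteq> {y. x \<bullet> y \<le> ln (exp_sum c A x) + C}"
      by (rule hull_minimal) (rule convex_halfspace_le)
    then show ?thesis using that by (auto simp: inner_commute)
  qed
  then show ?thesis by blast
qed

section \<open>Monotonicity of mixed volumes\<close>

text \<open>Unnormalised polarisation of the volume: on a constant tuple of a compact convex set it
  gives n! times the volume. The empty sum is the origin and contributes 0.\<close>

definition mixed_volume :: "('n \<Rightarrow> (real^'n) set) \<Rightarrow> real" where
  "mixed_volume K = (\<Sum>I\<in>Pow UNIV. (-1) ^ (CARD('n) - card I) * measure lebesgue (\<Sum>i\<in>I. K i))"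

text \<open>The mixed discriminant of the Hessians, in the same unnormalised polarisation as
  \<open>mixed_volume\<close>.\<close>

definition mixed_density :: "('n \<Rightarrow> real^'n \<Rightarrow> real) \<Rightarrow> ('n \<Rightarrow> (real^'n) set) \<Rightarrow> real^'n \<Rightarrow> real" where
  "mixed_density c A x =
    (\<Sum>I\<in>Pow UNIV. (-1) ^ (CARD('n) - card I) * det (\<Sum>i\<in>I. gibbs_cov (c i) (A i) x))"

lemma sum_matrix_vector_mult: "(\<Sum>i\<in>I. M i) *v h = (\<Sum>i\<in>I. M i *v h)"
  for M :: "'i \<Rightarrow> real^'n^'m"
  by (induction I rule: infinite_finite_induct) (simp_all add: matrix_vector_mult_add_rdistrib)

text \<open>The sum of the matrices is a single nonnegative combination of outer products, indexed
  by a disjoint union.\<close>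

lemma det_sum_gibbs_cov_nonneg:
  fixes A :: "'i::finite \<Rightarrow> (real^'n) set"
  assumes "\<And>i. weighting (c i) (A i)"
  shows "0 \<le> det (\<Sum>i\<in>I. gibbs_cov (c i) (A i) x)"
proof -
  have fin: "finite (A i)" for i using assms by (simp add: weighting_def)
  have "(\<Sum>i\<in>I. gibbs_cov (c i) (A i) x) = (\<chi> r s. \<Sum>p\<in>Sigma I A. gibbs (c (fst p)) (A (fst p)) x (snd p) *
      (snd p - gibbs_mean (c (fst p)) (A (fst p)) x) $ r * (snd p - gibbs_mean (c (fst p)) (A (fst p)) x) $ s)"
    by (simp add: vec_eq_iff sum_component gibbs_cov_def sum.Sigma fin split_def)
  moreover have "gibbs (c (fst p)) (A (fst p)) x (snd p) \<ge> 0" if "p \<in> Sigma I A" for p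
    using that gibbs_nonneg[OF assms] by auto
  moreover have "finite (Sigma I A)" using fin by simp
  ultimately show ?thesis by (simp only: det_sum_outer_products_nonneg)
qed

lemma mixed_density_nonneg:
  assumes "\<And>i. weighting (c i) (A i)"
  shows "0 \<le> mixed_density c A x"
  unfolding mixed_density_def gibbs_cov_def
  by (rule mixed_discriminant_nonneg) (use assms gibbs_nonneg[OF assms] in \<open>auto simp: weighting_def\<close>)

lemma continuous_on_mixed_density:
  assumes "\<And>i. weighting (c i) (A i)"
  shows "continuous_on UNIV (mixed_density c A)"
  unfolding mixed_density_def[abs_def]
  by (intro continuous_on_sum continuous_on_mult continuous_on_const continuous_on_det_sum_gibbs_cov assms)

section \<open>Volumes and mixed volumes as integrals\<close>

lemma compact_convex_sum_set:
  fixes K :: "'i \<Rightarrow> (real^'n) set"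
  assumes "finite I" "\<And>i. i \<in> I \<Longrightarrow> compact (K i)" "\<And>i. i \<in> I \<Longrightarrow> convex (K i)"
  shows "compact (\<Sum>i\<in>I. K i)" "convex (\<Sum>i\<in>I. K i)"
proof -
  show "compact (\<Sum>i\<in>I. K i)"
    using assms(1,2)
  proof (induction I)
    case empty then show ?case by (simp add: set_zero)
  next
    case (insert i I)
    then have "K i + sum K I = {x + y |x y. x \<in> K i \<and> y \<in> sum K I}" by (auto simp: set_plus_def)
    with insert show ?case using compact_sums by fastforce
  qed
  show "convex (\<Sum>i\<in>I. K i)" using assms(3) by (rule convex_set_sum)
qed

text \<open>The potential is the sum of the logarithms: gradients, Hessians and lower bounds add up,
  and the gradient takes values in the Minkowski sum of the hulls. A vanishing sum of nonnegative
  quadratic forms has vanishing summands, which gives the kernel condition.\<close>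

lemma integral_det_sum_gibbs_cov:
  fixes A :: "'i::finite \<Rightarrow> (real^'n) set" and I :: "'i set"
  assumes A: "\<And>i. finite (A i)" "\<And>i. A i \<noteq> {}" and pos: "\<And>i a. a \<in> A i \<Longrightarrow> 0 < c i a"
  defines "K \<equiv> \<Sum>i\<in>I. convex hull A i"
  shows "has_bochner_integral lborel (\<lambda>x. det (\<Sum>i\<in>I. gibbs_cov (c i) (A i) x)) (measure lebesgue K)"
proof -
  have wt: "weighting (c i) (A i)" for i using A pos by (rule weighting_pos)
  let ?F = "\<lambda>x. \<Sum>i\<in>I. ln (exp_sum (c i) (A i) x)" and ?G = "\<lambda>x. \<Sum>i\<in>I. gibbs_mean (c i) (A i) x"
  let ?H = "\<lambda>x. \<Sum>i\<in>I. gibbs_cov (c i) (A i) x"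
  have K: "compact K" "convex K"
    unfolding K_def by (rule compact_convex_sum_set; use A(1) finite_imp_compact_convex_hull in auto)+
  have cont: "continuous_on UNIV (\<lambda>x. det (?H x))"
    by (rule continuous_on_det_sum_gibbs_cov) (rule wt)
  have nonneg: "0 \<le> det (?H x)" for x by (rule det_sum_gibbs_cov_nonneg) (rule wt)
  have "\<forall>i. \<exists>C. \<forall>k\<in>convex hull A i. \<forall>x. k \<bullet> x \<le> ln (exp_sum (c i) (A i) x) + C"
    using hull_inner_le_ln_exp_sum[OF A pos] by (rule allI)
  from choice[OF this] obtain C
    where "\<forall>i. \<forall>k\<in>convex hull A i. \<forall>x. k \<bullet> x \<le> ln (exp_sum (c i) (A i) x) + C i" ..
  then have C: "k \<bullet> x \<le> ln (exp_sum (c i) (A i) x) + C i" if "k \<in> convex hull A i" for i k x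
    using that by blast
  have "(\<integral>\<^sup>+x. ennreal \<bar>det (?H x)\<bar> \<partial>lborel) = emeasure lborel K"
  proof (rule nn_integral_hessian_eq_volume[where F = ?F and G = ?G and c = "sum C I"])
    fix x
    have "(?F has_derivative (\<lambda>h. \<Sum>i\<in>I. gibbs_mean (c i) (A i) x \<bullet> h)) (at x)"
      by (intro has_derivative_sum ln_exp_sum_has_derivative wt)
    then show "(?F has_derivative (\<lambda>h. ?G x \<bullet> h)) (at x)" by (simp add: inner_sum_left)
    have "(?G has_derivative (\<lambda>h. \<Sum>i\<in>I. gibbs_cov (c i) (A i) x *v h)) (at x)"
      by (intro has_derivative_sum gibbs_mean_has_derivative wt)
    then show "(?G has_derivative (\<lambda>h. ?H x *v h)) (at x)" by (simp add: sum_matrix_vector_mult)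
    show "?G x \<in> K"
      unfolding K_def set_sum_alt[OF finite] using gibbs_mean_in_hull[OF wt] by blast
    fix h
    have split: "h \<bullet> (?H x *v h) = (\<Sum>i\<in>I. h \<bullet> (gibbs_cov (c i) (A i) x *v h))"
      by (simp add: sum_matrix_vector_mult inner_sum_right)
    show "0 \<le> h \<bullet> (?H x *v h)"
      unfolding split by (intro sum_nonneg inner_gibbs_cov_nonneg wt)
    assume "h \<bullet> (?H x *v h) = 0"
    then have "\<forall>i\<in>I. h \<bullet> (gibbs_cov (c i) (A i) x *v h) = 0"
      unfolding split by (subst (asm) sum_nonneg_eq_0_iff) (use inner_gibbs_cov_nonneg[OF wt] in auto)
    then show "?H x *v h = 0"
      by (simp add: sum_matrix_vector_mult gibbs_cov_kernel[OF wt])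
  next
    fix k x assume "k \<in> K"
    then obtain s where s: "k = sum s I" "\<And>i. i \<in> I \<Longrightarrow> s i \<in> convex hull A i"
      unfolding K_def set_sum_alt[OF finite] by blast
    have "k \<bullet> x = (\<Sum>i\<in>I. s i \<bullet> x)" by (simp add: s inner_sum_left)
    also have "\<dots> \<le> (\<Sum>i\<in>I. ln (exp_sum (c i) (A i) x) + C i)" using s C by (intro sum_mono) auto
    finally show "k \<bullet> x \<le> ?F x + sum C I" by (simp add: sum.distrib)
  qed (use K cont in auto)
  then have "(\<integral>\<^sup>+x. ennreal (det (?H x)) \<partial>lborel) = emeasure lborel K"
    by (simp add: nonneg)
  also have "\<dots> = ennreal (measure lebesgue K)"
  proof -
    have "K \<in> lmeasurable" using K(1) lmeasurable_compact by blast
    then have "emeasure lebesgue K = ennreal (measure lebesgue K)" by (simp add: emeasure_eq_measure2)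
    then show ?thesis using K(1) by (simp add: borel_compact)
  qed
  finally show ?thesis
    by (intro has_bochner_integral_nn_integral)
      (use nonneg in \<open>auto intro!: borel_measurable_continuous_onI cont\<close>)
qed

lemma integral_mixed_density:
  fixes A :: "'n::finite \<Rightarrow> (real^'n) set"
  assumes A: "\<And>i. finite (A i)" "\<And>i. A i \<noteq> {}" and pos: "\<And>i a. a \<in> A i \<Longrightarrow> 0 < c i a"
  shows "has_bochner_integral lborel (mixed_density c A) (mixed_volume (\<lambda>i. convex hull A i))"
  unfolding mixed_density_def[abs_def] mixed_volume_def
  by (intro has_bochner_integral_sum has_bochner_integral_mult_right integral_det_sum_gibbs_cov assms)

text \<open>The value is the same for all positive weights, so the weights can be varied without
  changing the integral. The form as a nonnegative integral is the one that Fatou's lemma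
  takes.\<close>

lemma nn_integral_mixed_density:
  fixes A :: "'n::finite \<Rightarrow> (real^'n) set"
  assumes A: "\<And>i. finite (A i)" "\<And>i. A i \<noteq> {}" and pos: "\<And>i a. a \<in> A i \<Longrightarrow> 0 < c i a"
  shows "(\<integral>\<^sup>+x. ennreal (mixed_density c A x) \<partial>lborel) = ennreal (mixed_volume (\<lambda>i. convex hull A i))"
    and "0 \<le> mixed_volume (\<lambda>i. convex hull A i)"
proof -
  have wt: "weighting (c i) (A i)" for i using A pos by (rule weighting_pos)
  note * = has_bochner_integral_iff[THEN iffD1, OF integral_mixed_density[OF assms]]
  show "0 \<le> mixed_volume (\<lambda>i. convex hull A i)"
    using * Bochner_Integration.integral_nonneg[of lborel "mixed_density c A"] mixed_density_nonneg[OF wt]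
    by simp
  show "(\<integral>\<^sup>+x. ennreal (mixed_density c A x) \<partial>lborel) = ennreal (mixed_volume (\<lambda>i. convex hull A i))"
    using nn_integral_eq_integral[of lborel "mixed_density c A"] * mixed_density_nonneg[OF wt] by simp
qed

section \<open>Degenerating weights and monotonicity\<close>

lemma gibbs_cov_support:
  assumes "weighting c A" "A \<subseteq> B" "finite B" "\<And>a. a \<in> A \<Longrightarrow> d a = c a" "\<And>a. a \<in> B - A \<Longrightarrow> d a = 0"
  shows "gibbs_cov d B x = gibbs_cov c A x"
proof -
  have Z: "exp_sum d B x = exp_sum c A x"
    unfolding exp_sum_def by (rule sum.mono_neutral_cong_right) (use assms in auto)
  have p: "gibbs d B x a = gibbs c A x a" if "a \<in> A" for a
    using that assms(4) Z by (simp add: gibbs_def)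
  have q: "gibbs d B x a = 0" if "a \<in> B - A" for a
    using that assms(5) by (simp add: gibbs_def)
  have "gibbs_mean d B x = gibbs_mean c A x"
    unfolding gibbs_mean_def by (rule sum.mono_neutral_cong_right) (use assms p q in auto)
  then show ?thesis
    unfolding gibbs_cov_def vec_eq_iff vec_lambda_beta
    by (intro allI sum.mono_neutral_cong_right) (use assms p q in auto)
qed

text \<open>At fixed \<open>x\<close> the density is a rational expression in the weights, with
  denominators whose limits are positive.\<close>

lemma tendsto_mixed_density:
  fixes c :: "nat \<Rightarrow> 'n::finite \<Rightarrow> real^'n \<Rightarrow> real"
  assumes wt: "\<And>i. weighting (d i) (A i)" and lim: "\<And>i a. (\<lambda>k. c k i a) \<longlonglongrightarrow> d i a"
  shows "(\<lambda>k. mixed_density (c k) A x) \<longlonglongrightarrow> mixed_density d A x"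
proof -
  have p: "(\<lambda>k. gibbs (c k i) (A i) x a) \<longlonglongrightarrow> gibbs (d i) (A i) x a" for i a
    unfolding gibbs_def exp_sum_def
    by (intro tendsto_intros lim) (use exp_sum_pos[OF wt, of i x] in \<open>simp add: exp_sum_def\<close>)
  have m: "(\<lambda>k. gibbs_mean (c k i) (A i) x) \<longlonglongrightarrow> gibbs_mean (d i) (A i) x" for i
    unfolding gibbs_mean_def by (intro tendsto_intros p)
  have "(\<lambda>k. (\<Sum>i\<in>I. gibbs_cov (c k i) (A i) x) $ r $ s) \<longlonglongrightarrow>
      (\<Sum>i\<in>I. gibbs_cov (d i) (A i) x) $ r $ s" for I r s
    unfolding sum_component gibbs_cov_def vec_lambda_beta by (intro tendsto_intros p m)
  then show ?thesis
    unfolding mixed_density_def det_def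
    by (intro tendsto_sum tendsto_mult tendsto_prod tendsto_const)
qed

lemma mixed_volume_hull_mono:
  fixes A B :: "'n::finite \<Rightarrow> (real^'n) set"
  assumes AB: "\<And>i. A i \<subseteq> B i" and fin: "\<And>i. finite (B i)" and ne: "\<And>i. A i \<noteq> {}"
  shows "mixed_volume (\<lambda>i. convex hull A i) \<le> mixed_volume (\<lambda>i. convex hull B i)"
proof -
  define c where "c k i a = (if a \<in> A i then 1 else 1 / real (Suc k))" for k :: nat and i and a :: "real^'n"
  \<comment> \<open>the limit weights vanish off \<open>A\<close>, so they give the density of the smaller configuration\<close>
  define d where "d i a = (if a \<in> A i then 1 else 0 :: real)" for i and a :: "real^'n"
  have finA: "finite (A i)" for i using AB fin finite_subset by blast
  have neB: "B i \<noteq> {}" for i using AB ne by blast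
  have wd: "weighting (d i) (B i)" for i
    using ne[of i] AB[of i] fin by (auto simp: weighting_def d_def)
  have pos: "0 < c k i a" for k i a by (simp add: c_def)
  have wc: "weighting (c k i) (B i)" for k i
    using pos fin neB[of i] by (auto simp: weighting_def less_imp_le)
  have lim: "(\<lambda>k. c k i a) \<longlonglongrightarrow> d i a" for i a
    unfolding c_def d_def using LIMSEQ_inverse_real_of_nat by (simp add: inverse_eq_divide)
  have dens: "mixed_density d B = mixed_density (\<lambda>i a. 1) A"
  proof -
    have "gibbs_cov (d i) (B i) x = gibbs_cov (\<lambda>a. 1) (A i) x" for i x
      by (rule gibbs_cov_support) (use AB fin weighting_pos[OF finA ne] in \<open>auto simp: d_def\<close>)
    then show ?thesis by (simp add: mixed_density_def[abs_def])
  qed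
  have "ennreal (mixed_volume (\<lambda>i. convex hull A i)) = (\<integral>\<^sup>+x. ennreal (mixed_density d B x) \<partial>lborel)"
    unfolding dens by (rule nn_integral_mixed_density(1)[symmetric]) (use finA ne in auto)
  also have "\<dots> = (\<integral>\<^sup>+x. liminf (\<lambda>k. ennreal (mixed_density (c k) B x)) \<partial>lborel)"
    by (intro nn_integral_cong lim_imp_Liminf[symmetric] tendsto_ennrealI tendsto_mixed_density wd lim) simp
  \<comment> \<open>Fatou's lemma. Mass may be lost in the limit, so only an inequality results, in
    the direction that is needed.\<close>
  also have "\<dots> \<le> liminf (\<lambda>k. \<integral>\<^sup>+x. ennreal (mixed_density (c k) B x) \<partial>lborel)"
  proof (rule nn_integral_liminf)
    fix k
    have "mixed_density (c k) B \<in> borel_measurable borel"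
      by (intro borel_measurable_continuous_onI continuous_on_mixed_density wc)
    then show "(\<lambda>x. ennreal (mixed_density (c k) B x)) \<in> borel_measurable lborel" by simp
  qed
  \<comment> \<open>All weights \<open>c k\<close> are positive on \<open>B\<close>, so the integral
    is the same for every \<open>k\<close>.\<close>
  also have "\<dots> = ennreal (mixed_volume (\<lambda>i. convex hull B i))"
    by (simp add: nn_integral_mixed_density(1)[OF fin neB pos] Liminf_const)
  finally show ?thesis
    using nn_integral_mixed_density(2)[of B "\<lambda>_ _. 1"] fin neB by (simp add: ennreal_le_iff)
qed

text \<open>The generators of \<open>K i\<close> are added to those of \<open>L i\<close>, which
  leaves \<open>L i\<close> unchanged and makes the generating sets nested.\<close>

lemma mixed_volume_mono:
  fixes K L :: "'n::finite \<Rightarrow> (real^'n) set"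
  assumes "\<And>i. polytope (K i)" "\<And>i. polytope (L i)" "\<And>i. K i \<subseteq> L i" "\<And>i. K i \<noteq> {}"
  shows "mixed_volume K \<le> mixed_volume L"
proof -
  obtain A where A: "\<And>i. finite (A i)" "\<And>i. K i = convex hull A i"
    using assms(1) unfolding polytope_def by metis
  obtain B where B: "\<And>i. finite (B i)" "\<And>i. L i = convex hull B i"
    using assms(2) unfolding polytope_def by metis
  have "convex hull (A i \<union> B i) = L i" for i
  proof
    show "convex hull (A i \<union> B i) \<subseteq> L i"
      using assms(3)[of i] A(2) B(2) by (intro hull_minimal) (auto intro: hull_inc)
    show "L i \<subseteq> convex hull (A i \<union> B i)" unfolding B(2) by (rule hull_mono) auto
  qed
  then have "L = (\<lambda>i. convex hull (A i \<union> B i))" "K = (\<lambda>i. convex hull A i)"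
    using A(2) by (auto simp: fun_eq_iff)
  then show ?thesis
    using mixed_volume_hull_mono[of A "\<lambda>i. A i \<union> B i"] A B assms(4) by (metis finite_UnI convex_hull_empty sup_ge1)
qed

section \<open>Truncation by a simplex\<close>

definition coord_sum :: "real^'n \<Rightarrow> real" where
  "coord_sum x = (\<Sum>j\<in>UNIV. x $ j)"

definition corner_simplex :: "real \<Rightarrow> (real^'n) set" where
  "corner_simplex M = {x \<in> positive_orthant. coord_sum x \<le> M}"

text \<open>The level \<open>M\<close> is a quantitative witness that \<open>B\<close> has bounded
  complement in the orthant; such levels add under Minkowski sums.\<close>

definition coconvex :: "real \<Rightarrow> (real^'n) set \<Rightarrow> bool" where
  "coconvex M B \<longleftrightarrow> B \<subseteq> positive_orthant \<and> convex B \<and> (\<forall>x\<in>positive_orthant. M \<le> coord_sum x \<longrightarrow> x \<in> B)"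

lemma coord_sum_linear [simp]:
  "coord_sum (x + y) = coord_sum x + coord_sum y" "coord_sum (x - y) = coord_sum x - coord_sum y"
  "coord_sum (t *\<^sub>R x) = t * coord_sum x" "coord_sum 0 = 0"
  by (simp_all add: coord_sum_def sum.distrib sum_subtractf sum_distrib_left)

lemma coord_sum_eq_inner: "coord_sum x = vec 1 \<bullet> x"
  by (simp add: coord_sum_def inner_vec_def)

lemma coord_sum_nonneg: "x \<in> positive_orthant \<Longrightarrow> 0 \<le> coord_sum x"
  by (simp add: coord_sum_def positive_orthant_def sum_nonneg)

lemma coord_sum_eq_0: "x \<in> positive_orthant \<Longrightarrow> coord_sum x = 0 \<longleftrightarrow> x = 0"
  by (auto simp: coord_sum_def positive_orthant_def sum_nonneg_eq_0_iff vec_eq_iff)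

lemma coord_sum_le_norm: "coord_sum x \<le> real CARD('n) * norm x" for x :: "real^'n"
  unfolding coord_sum_def
  by (rule order_trans[OF sum_bounded_above[of UNIV _ "norm x"]])
    (auto intro: order_trans[OF abs_ge_self component_le_norm_cart])

lemma norm_le_coord_sum: "x \<in> positive_orthant \<Longrightarrow> norm x \<le> coord_sum x"
  using norm_le_l1_cart[of x] by (simp add: coord_sum_def positive_orthant_def)

lemma orthant_add: "x \<in> positive_orthant \<Longrightarrow> y \<in> positive_orthant \<Longrightarrow> x + y \<in> positive_orthant"
  by (simp add: positive_orthant_def)

lemma orthant_scaleR: "x \<in> positive_orthant \<Longrightarrow> 0 \<le> t \<Longrightarrow> t *\<^sub>R x \<in> positive_orthant"
  by (simp add: positive_orthant_def)

lemma convex_orthant: "convex (positive_orthant :: (real^'n) set)"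
  unfolding convex_def by (simp add: orthant_add orthant_scaleR)

lemma polytope_corner_simplex: "polytope (corner_simplex M :: (real^'n) set)"
proof -
  have "(positive_orthant :: (real^'n) set) = \<Inter>(range (\<lambda>j. {x. axis j 1 \<bullet> x \<ge> 0}))"
    by (auto simp: positive_orthant_def inner_axis')
  moreover have "polyhedron (\<Inter>(range (\<lambda>j. {x :: real^'n. axis j 1 \<bullet> x \<ge> 0})))"
    by (intro polyhedron_Inter) (auto simp: polyhedron_halfspace_ge)
  ultimately have "polyhedron (positive_orthant :: (real^'n) set)" by simp
  moreover have "corner_simplex M = positive_orthant \<inter> {x :: real^'n. vec 1 \<bullet> x \<le> M}"
    by (auto simp: corner_simplex_def coord_sum_eq_inner)
  ultimately have "polyhedron (corner_simplex M :: (real^'n) set)"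
    by (simp add: polyhedron_halfspace_le)
  moreover have "bounded (corner_simplex M :: (real^'n) set)"
    unfolding bounded_iff corner_simplex_def using norm_le_coord_sum order_trans by blast
  ultimately show ?thesis by (simp add: polytope_eq_bounded_polyhedron)
qed

section \<open>Minkowski sums of coconvex sets and their truncations\<close>

lemma coconvex_mono: "coconvex M B \<Longrightarrow> M \<le> M' \<Longrightarrow> coconvex M' B"
  unfolding coconvex_def by (meson order_trans)

text \<open>Far out in direction \<open>y\<close> the ray from \<open>x\<close> reaches level
  \<open>M\<close> and so lies in \<open>B\<close>; by convexity \<open>B\<close> contains the
  points in between.\<close>

lemma coconvex_upset:
  assumes B: "coconvex M B" and x: "x \<in> B" and y: "y \<in> positive_orthant"
  shows "x + y \<in> B"
proof (cases "y = 0")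
  case False
  have xo: "x \<in> positive_orthant" using B x by (auto simp: coconvex_def)
  have pos: "coord_sum y > 0" using coord_sum_nonneg[OF y] coord_sum_eq_0[OF y] False by simp
  \<comment> \<open>Large enough for \<open>t *\<^sub>R y\<close> to reach level \<open>M\<close>,
    and at least 1 so that \<open>x + y\<close> lies between \<open>x\<close> and
    \<open>x + t *\<^sub>R y\<close>.\<close>
  define t where "t = max 1 (M / coord_sum y)"
  have "t \<ge> M / coord_sum y" and t: "t \<ge> 1" by (simp_all add: t_def)
  then have "t * coord_sum y \<ge> M" using pos by (simp add: field_simps)
  then have "x + t *\<^sub>R y \<in> B"
    using B t coord_sum_nonneg[OF xo] orthant_add[OF xo orthant_scaleR[OF y]] by (simp add: coconvex_def)
  then have "(1 - 1/t) *\<^sub>R x + (1/t) *\<^sub>R (x + t *\<^sub>R y) \<in> B"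
    using B x t by (intro convexD) (auto simp: coconvex_def)
  moreover have "(1 - 1/t) *\<^sub>R x + (1/t) *\<^sub>R (x + t *\<^sub>R y) = x + y"
    using t by (simp add: algebra_simps)
  ultimately show ?thesis by simp
qed (use x in simp)

text \<open>Splits a point above level \<open>s\<close> into a point of \<open>B\<close> exactly on
  that level and an excess in the orthant, which can be handed to another summand.\<close>

lemma scale_to_level:
  assumes "coconvex s B" "x \<in> positive_orthant" "0 < s" "s \<le> coord_sum x"
  shows "(s / coord_sum x) *\<^sub>R x \<in> B \<inter> corner_simplex s"
    and "x - (s / coord_sum x) *\<^sub>R x \<in> positive_orthant"
proof -
  have "(s / coord_sum x) *\<^sub>R x \<in> positive_orthant"
    using assms by (intro orthant_scaleR) auto
  moreover have "coord_sum ((s / coord_sum x) *\<^sub>R x) = s" using assms by simp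
  ultimately show "(s / coord_sum x) *\<^sub>R x \<in> B \<inter> corner_simplex s"
    using assms(1) by (simp add: coconvex_def corner_simplex_def)
  have "x - (s / coord_sum x) *\<^sub>R x = (1 - s / coord_sum x) *\<^sub>R x"
    by (simp add: algebra_simps)
  then show "x - (s / coord_sum x) *\<^sub>R x \<in> positive_orthant"
    using assms by (simp add: orthant_scaleR)
qed

text \<open>The part of \<open>b\<close> above level \<open>s\<close> is moved to \<open>b'\<close>, which stays in the upward closed set \<open>B'\<close>.\<close>

lemma truncated_sum_aux:
  assumes B: "coconvex s B" and B': "coconvex t B'" and s: "0 < s"
    and b: "b \<in> B" "b' \<in> B'" "coord_sum (b + b') \<le> s + t" "s \<le> coord_sum b"
  shows "b + b' \<in> (B \<inter> corner_simplex s) + (B' \<inter> corner_simplex t)"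
proof -
  let ?b = "(s / coord_sum b) *\<^sub>R b"
  have bo: "b \<in> positive_orthant" "b' \<in> positive_orthant" using B B' b by (auto simp: coconvex_def)
  note level = scale_to_level[OF B bo(1) s b(4)]
  have "coord_sum ?b = s" using s b(4) by simp
  moreover have "b' + (b - ?b) \<in> B'" using coconvex_upset[OF B' b(2) level(2)] .
  moreover have "b' + (b - ?b) \<in> positive_orthant" using orthant_add[OF bo(2) level(2)] .
  ultimately have "b' + (b - ?b) \<in> B' \<inter> corner_simplex t"
    using b(3) by (simp add: corner_simplex_def)
  moreover have "b + b' = ?b + (b' + (b - ?b))" by simp
  ultimately show ?thesis using level(1) by (metis set_plus_intro)
qed

text \<open>A point at level \<open>s + t\<close> or higher is divided in the ratio of
  \<open>s\<close> to \<open>t\<close>. For the truncations, a summand above its own level passes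
  its excess to the other one, which then stays below its level.\<close>

lemma coconvex_add:
  assumes B: "coconvex s B" and B': "coconvex t B'" and st: "0 < s" "0 < t"
  shows "coconvex (s + t) (B + B')"
    and "(B + B') \<inter> corner_simplex (s + t) = (B \<inter> corner_simplex s) + (B' \<inter> corner_simplex t)"
proof -
  have sub: "B \<subseteq> positive_orthant" "B' \<subseteq> positive_orthant" using B B' by (auto simp: coconvex_def)
  have "x \<in> B + B'" if x: "x \<in> positive_orthant" "s + t \<le> coord_sum x" for x
  proof -
    have "(s / (s + t)) *\<^sub>R x \<in> B"
    proof -
      have "s * (s + t) \<le> s * coord_sum x" using x st by (intro mult_left_mono) auto
      then have "s \<le> s / (s + t) * coord_sum x" using st by (simp add: field_simps)
      moreover have "(s / (s + t)) *\<^sub>R x \<in> positive_orthant" using x st by (intro orthant_scaleR) auto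
      ultimately show ?thesis using B by (simp add: coconvex_def)
    qed
    moreover have "(t / (s + t)) *\<^sub>R x \<in> B'"
    proof -
      have "t * (s + t) \<le> t * coord_sum x" using x st by (intro mult_left_mono) auto
      then have "t \<le> t / (s + t) * coord_sum x" using st by (simp add: field_simps)
      moreover have "(t / (s + t)) *\<^sub>R x \<in> positive_orthant" using x st by (intro orthant_scaleR) auto
      ultimately show ?thesis using B' by (simp add: coconvex_def)
    qed
    moreover have "x = (s / (s + t)) *\<^sub>R x + (t / (s + t)) *\<^sub>R x"
      using st by (simp add: scaleR_add_left[symmetric] add_divide_distrib[symmetric])
    ultimately show ?thesis by (metis set_plus_intro)
  qed
  moreover have "B + B' \<subseteq> positive_orthant"
    using sub orthant_add by (auto elim!: set_plus_elim)
  ultimately show "coconvex (s + t) (B + B')"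
    using B B' by (simp add: coconvex_def convex_set_plus)
  show "(B + B') \<inter> corner_simplex (s + t) = (B \<inter> corner_simplex s) + (B' \<inter> corner_simplex t)"
  proof
    show "(B \<inter> corner_simplex s) + (B' \<inter> corner_simplex t) \<subseteq> (B + B') \<inter> corner_simplex (s + t)"
      by (auto elim!: set_plus_elim intro!: set_plus_intro simp: corner_simplex_def intro: orthant_add)
    show "(B + B') \<inter> corner_simplex (s + t) \<subseteq> (B \<inter> corner_simplex s) + (B' \<inter> corner_simplex t)"
    proof
      fix x assume x: "x \<in> (B + B') \<inter> corner_simplex (s + t)"
      then obtain b b' where b: "x = b + b'" "b \<in> B" "b' \<in> B'" by (auto elim: set_plus_elim)
      have le: "coord_sum (b + b') \<le> s + t" using x b(1) by (simp add: corner_simplex_def)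
      consider "s \<le> coord_sum b" | "t \<le> coord_sum b'" | "coord_sum b \<le> s" "coord_sum b' \<le> t" by linarith
      then show "x \<in> (B \<inter> corner_simplex s) + (B' \<inter> corner_simplex t)"
      proof cases
        case 1 then show ?thesis using truncated_sum_aux[OF B B' st(1) b(2,3) le] b(1) by simp
      next
        case 2
        have "b' + b \<in> (B' \<inter> corner_simplex t) + (B \<inter> corner_simplex s)"
          using truncated_sum_aux[OF B' B st(2) b(3,2) _ 2] le by (simp add: add.commute)
        then show ?thesis using b(1) by (simp add: add.commute)
      next
        case 3
        then show ?thesis using b sub by (auto simp: corner_simplex_def)
      qed
    qed
  qed
qed

lemma coconvex_sum:
  assumes "finite I" "I \<noteq> {}" "\<And>i. i \<in> I \<Longrightarrow> coconvex M (B i)" "0 < M"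
  shows "coconvex (real (card I) * M) (\<Sum>i\<in>I. B i) \<and>
    (\<Sum>i\<in>I. B i) \<inter> corner_simplex (real (card I) * M) = (\<Sum>i\<in>I. B i \<inter> corner_simplex M)"
  using assms(1-3)
proof (induction I rule: finite_ne_induct)
  case (insert i I)
  then have IH: "coconvex (real (card I) * M) (\<Sum>i\<in>I. B i)"
    "(\<Sum>i\<in>I. B i) \<inter> corner_simplex (real (card I) * M) = (\<Sum>i\<in>I. B i \<inter> corner_simplex M)" by auto
  have "0 < real (card I) * M" using insert assms(4) by (simp add: card_gt_0_iff)
  note add = coconvex_add[OF insert.prems[of i] IH(1) assms(4) this]
  have "real (card (insert i I)) * M = M + real (card I) * M"
    using insert by (simp add: algebra_simps)
  then show ?case using add IH(2) insert by simp
qed simp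

text \<open>From level \<open>card I * M\<close> on the sum fills the orthant, so its complement is
  the simplex at that level minus the sum of the truncations.\<close>

lemma rel_volume_minkowski_sum:
  fixes B :: "'n::finite \<Rightarrow> (real^'n) set"
  assumes B: "\<And>i. coconvex M (B i)" and M: "0 < M" and poly: "\<And>i. polytope (B i \<inter> corner_simplex M)"
  shows "rel_volume positive_orthant (rel_minkowski_sum positive_orthant B I) =
    fact CARD('n) * (measure lebesgue (corner_simplex (real (card I) * M) :: (real^'n) set) -
      measure lebesgue (\<Sum>i\<in>I. B i \<inter> corner_simplex M))"
proof (cases "I = {}")
  case True
  \<comment> \<open>For empty \<open>I\<close> the relative sum is the whole orthant, with empty
    complement, while on the right both the simplex and the sum are the origin.\<close>
  have "corner_simplex 0 = {0 :: real^'n}"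
    using coord_sum_eq_0 coord_sum_nonneg by (fastforce simp: corner_simplex_def positive_orthant_def)
  then show ?thesis
    using True by (simp add: rel_volume_def rel_minkowski_sum_def set_zero)
next
  case False
  let ?\<Delta> = "corner_simplex (real (card I) * M) :: (real^'n) set" and ?K = "\<Sum>i\<in>I. B i \<inter> corner_simplex M"
  have co: "coconvex (real (card I) * M) (\<Sum>i\<in>I. B i)" and eq: "(\<Sum>i\<in>I. B i) \<inter> ?\<Delta> = ?K"
    using coconvex_sum[of I M B] False B M by auto
  have diff: "positive_orthant - (\<Sum>i\<in>I. B i) = ?\<Delta> - ?K"
    using co unfolding eq[symmetric] by (force simp: coconvex_def corner_simplex_def)
  have "?\<Delta> \<in> lmeasurable" using polytope_corner_simplex polytope_imp_compact lmeasurable_compact by blast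
  moreover have "compact ?K"
    by (rule compact_convex_sum_set(1)) (use poly polytope_imp_compact polytope_imp_convex in auto)
  then have "?K \<in> lmeasurable" by (rule lmeasurable_compact)
  moreover have "?K \<subseteq> ?\<Delta>" using eq by blast
  ultimately have "measure lebesgue (?\<Delta> - ?K) = measure lebesgue ?\<Delta> - measure lebesgue ?K"
    by (rule measurable_measure_Diff[OF _ fmeasurableD])
  then show ?thesis using False by (simp add: rel_volume_def rel_minkowski_sum_def diff)
qed

text \<open>The simplex terms depend on \<open>M\<close> only. With a common \<open>M\<close>, the
  relative mixed volume is therefore a positive multiple of a constant minus the mixed volume of the
  truncations, which reverses monotonicity.\<close>

lemma rel_mixed_volume_antimono:
  fixes B B' :: "'n::finite \<Rightarrow> (real^'n) set"
  assumes B: "\<And>i. coconvex M (B i)" "\<And>i. polytope (B i \<inter> corner_simplex M)"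
    and B': "\<And>i. coconvex M (B' i)" "\<And>i. polytope (B' i \<inter> corner_simplex M)"
    and M: "0 < M" and sub: "\<And>i. B i \<subseteq> B' i"
  shows "rel_mixed_volume positive_orthant B' \<le> rel_mixed_volume positive_orthant B"
proof -
  define \<Delta> where "\<Delta> = (\<Sum>I\<in>Pow (UNIV :: 'n set). (-1) ^ (CARD('n) - card I) *
    measure lebesgue (corner_simplex (real (card I) * M) :: (real^'n) set))"
  have eq: "rel_mixed_volume positive_orthant D =
      fact CARD('n) * (\<Delta> - mixed_volume (\<lambda>i. D i \<inter> corner_simplex M))"
    if "\<And>i. coconvex M (D i)" "\<And>i. polytope (D i \<inter> corner_simplex M)" for D :: "'n \<Rightarrow> (real^'n) set"
    unfolding rel_mixed_volume_def rel_volume_minkowski_sum[OF that(1) M that(2)] \<Delta>_def mixed_volume_def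
    by (simp add: sum_subtractf[symmetric] sum_distrib_left algebra_simps)
  have "mixed_volume (\<lambda>i. B i \<inter> corner_simplex M) \<le> mixed_volume (\<lambda>i. B' i \<inter> corner_simplex M)"
  proof (rule mixed_volume_mono)
    fix i
    show "B i \<inter> corner_simplex M \<subseteq> B' i \<inter> corner_simplex M" using sub[of i] by blast
    \<comment> \<open>A point of the orthant on level \<open>M\<close> lies in all the truncations;
      \<open>undefined\<close> stands for an arbitrary coordinate.\<close>
    let ?x = "axis undefined M :: real^'n"
    have "?x \<in> positive_orthant" "coord_sum ?x = M"
      using M by (auto simp: positive_orthant_def axis_def coord_sum_def sum.delta)
    then have "?x \<in> B i \<inter> corner_simplex M" using B(1)[of i] by (simp add: coconvex_def corner_simplex_def)
    then show "B i \<inter> corner_simplex M \<noteq> {}" by blast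
  qed (use B B' in auto)
  then show ?thesis using eq[OF B] eq[OF B'] by (simp add: mult_left_mono)
qed

section \<open>Adding one point to a coconvex set\<close>

lemma coconvex_hull_insert:
  assumes B: "coconvex M B" and \<delta>: "\<delta> \<in> positive_orthant"
  shows "coconvex M (convex hull (B \<union> {\<delta>}))"
proof -
  have "convex hull (B \<union> {\<delta>}) \<subseteq> positive_orthant"
    using B \<delta> by (intro hull_minimal convex_orthant) (auto simp: coconvex_def)
  moreover have "B \<subseteq> convex hull (B \<union> {\<delta>})" by (meson Un_subset_iff hull_subset)
  ultimately show ?thesis using B by (auto simp: coconvex_def)
qed

text \<open>Truncation commutes with adding a point \<open>\<delta>\<close> below level
  \<open>M\<close>, so the result is the hull of \<open>\<delta>\<close> and the polytope
  \<open>B \<inter> corner_simplex M\<close>.\<close>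

lemma polytope_truncated_hull_insert:
  assumes B: "coconvex M B" and poly: "polytope (B \<inter> corner_simplex M)"
    and \<delta>: "\<delta> \<in> positive_orthant" "coord_sum \<delta> < M"
  shows "polytope (convex hull (B \<union> {\<delta>}) \<inter> corner_simplex M)"
proof -
  let ?P = "convex hull insert \<delta> (B \<inter> corner_simplex M)"
  have "B \<noteq> {}"
  proof -
    have "axis undefined M \<in> B"
      using B \<delta> coord_sum_nonneg[OF \<delta>(1)]
      by (auto simp: coconvex_def positive_orthant_def axis_def coord_sum_def sum.delta)
    then show ?thesis by blast
  qed
  have "x \<in> ?P" if x: "x \<in> convex hull (B \<union> {\<delta>})" "x \<in> corner_simplex M" for x
  proof -
    have "convex hull B = B" using B by (simp add: coconvex_def convex_hull_eq)
    then obtain b u where b: "b \<in> B" and u: "x = (1 - u) *\<^sub>R \<delta> + u *\<^sub>R b" "0 \<le> u" "u \<le> 1"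
      using x(1) \<open>B \<noteq> {}\<close> by (auto simp: convex_hull_insert_alt)
    have bo: "b \<in> positive_orthant" using b B by (auto simp: coconvex_def)
    show ?thesis
    proof (cases "coord_sum b \<le> M")
      case True
      then have "b \<in> ?P" using b bo by (intro hull_inc) (simp add: corner_simplex_def)
      moreover have "\<delta> \<in> ?P" by (rule hull_inc) simp
      ultimately show ?thesis unfolding u(1) using u by (intro convexD convex_convex_hull) auto
    next
      case False
      \<comment> \<open>The parameter at which the segment from \<open>\<delta>\<close> to
        \<open>b\<close> crosses level \<open>M\<close>. The crossing point \<open>p\<close> lies in
        \<open>B\<close> and replaces \<open>b\<close>.\<close>
      define s where "s = (M - coord_sum \<delta>) / (coord_sum b - coord_sum \<delta>)"
      have s: "0 < s" "s < 1" using False \<delta>(2) by (auto simp: s_def)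
      define p where "p = (1 - s) *\<^sub>R \<delta> + s *\<^sub>R b"
      have "coord_sum p = coord_sum \<delta> + s * (coord_sum b - coord_sum \<delta>)" by (simp add: p_def algebra_simps)
      also have "\<dots> = M" using False \<delta>(2) by (simp add: s_def)
      finally have pM: "coord_sum p = M" .
      moreover have "p \<in> positive_orthant"
        unfolding p_def using s \<delta>(1) bo by (intro orthant_add orthant_scaleR) auto
      ultimately have "p \<in> B \<inter> corner_simplex M" using B by (simp add: coconvex_def corner_simplex_def)
      then have p: "p \<in> ?P" by (intro hull_inc) simp
      have "coord_sum x = coord_sum \<delta> + u * (coord_sum b - coord_sum \<delta>)" by (simp add: u(1) algebra_simps)
      then have "u * (coord_sum b - coord_sum \<delta>) \<le> M - coord_sum \<delta>"
        using x(2) by (simp add: corner_simplex_def)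
      then have "u \<le> s" using False \<delta>(2) by (simp add: s_def pos_le_divide_eq)
      then have "x = (1 - u / s) *\<^sub>R \<delta> + (u / s) *\<^sub>R p"
        using s by (simp add: u(1) p_def algebra_simps)
      moreover have "\<delta> \<in> ?P" by (rule hull_inc) simp
      ultimately show ?thesis using p u \<open>u \<le> s\<close> s
        by (metis convexD convex_convex_hull diff_add_cancel diff_ge_0_iff_ge divide_le_eq_1_pos divide_nonneg_pos)
    qed
  qed
  moreover have "?P \<subseteq> convex hull (B \<union> {\<delta>})" by (rule hull_mono) auto
  moreover have "?P \<subseteq> corner_simplex M"
    using \<delta> polytope_imp_convex[OF polytope_corner_simplex, of M]
    by (intro hull_minimal) (auto simp: corner_simplex_def)
  ultimately have "convex hull (B \<union> {\<delta>}) \<inter> corner_simplex M = ?P" by blast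
  moreover obtain F where "finite F" "B \<inter> corner_simplex M = convex hull F"
    using poly by (auto simp: polytope_def)
  moreover have "convex hull insert \<delta> (convex hull F) = convex hull insert \<delta> F"
    by (rule hull_insert[symmetric])
  ultimately show ?thesis by (metis finite_insert polytope_def)
qed

section \<open>Lattice polyhedra in the orthant\<close>

text \<open>Stated for all large levels so that finitely many sets can share one level.\<close>

lemma eventually_coconvex:
  assumes "B \<subseteq> positive_orthant" "convex B" "bounded (positive_orthant - B)"
  shows "\<forall>\<^sub>F M in at_top. coconvex M B"
proof -
  obtain b where b: "\<And>x. x \<in> positive_orthant - B \<Longrightarrow> norm x \<le> b"
    using assms(3) by (auto simp: bounded_iff)
  let ?M = "real CARD('a) * b + 1"
  have "x \<in> B" if "x \<in> positive_orthant" "?M \<le> coord_sum x" for x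
  proof (rule ccontr)
    assume "x \<notin> B"
    then have "real CARD('a) * norm x \<le> real CARD('a) * b" using b that(1) by (intro mult_left_mono) auto
    then show False using coord_sum_le_norm[of x] that(2) by linarith
  qed
  then have "coconvex ?M B" using assms by (simp add: coconvex_def)
  then show ?thesis by (intro eventually_mono[OF eventually_ge_at_top[of ?M]]) (rule coconvex_mono)
qed

text \<open>\<open>B\<close> contains all far points of each coordinate axis, where a negative
  coefficient would make the functional arbitrarily small.\<close>

lemma coconvex_halfspace_normal_nonneg:
  assumes B: "coconvex M B" and w: "\<And>x. x \<in> B \<Longrightarrow> w \<bullet> x > b"
  shows "0 \<le> w $ j"
proof (rule ccontr)
  assume "\<not> 0 \<le> w $ j"
  define t where "t = max (max M 0) (b / w $ j)"
  have "t \<ge> b / w $ j" "t \<ge> M" "t \<ge> 0" by (auto simp: t_def)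
  moreover have "coord_sum (axis j t) = t" by (simp add: coord_sum_def axis_def sum.delta)
  ultimately have "axis j t \<in> B" using B by (auto simp: coconvex_def positive_orthant_def axis_def)
  then have "w $ j * t > b" using w[of "axis j t"] by (simp add: inner_axis)
  moreover have "w $ j * t \<le> b"
    using \<open>t \<ge> b / w $ j\<close> \<open>\<not> 0 \<le> w $ j\<close> by (simp add: field_simps)
  ultimately show False by simp
qed

text \<open>A point of \<open>P\<close> outside \<open>B\<close> is separated from \<open>B\<close>
  by a functional that, after perturbation, attains its minimum over \<open>P\<close> at a vertex.
  This vertex is a lattice point, hence in \<open>B\<close>, yet lies on the wrong side.\<close>

lemma lattice_polyhedron_subset:
  fixes P :: "(real^'n) set"
  assumes P: "lattice_polyhedron P" "P \<subseteq> positive_orthant" and B: "coconvex M B" "closed B"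
    and lat: "\<And>v. v \<in> P \<Longrightarrow> \<forall>j. v $ j \<in> \<int> \<Longrightarrow> v \<in> B"
  shows "P \<subseteq> B"
proof (rule ccontr)
  assume "\<not> P \<subseteq> B"
  then obtain x where x: "x \<in> P" "x \<notin> B" by blast
  have poly: "polyhedron P" using P(1) by (simp add: lattice_polyhedron_def)
  have "convex B" using B by (simp add: coconvex_def)
  then obtain w b where w: "w \<bullet> x < b" "\<And>y. y \<in> B \<Longrightarrow> w \<bullet> y > b"
    using separating_hyperplane_closed_point[of B x] B(2) x(2) by blast
  have xo: "x \<in> positive_orthant" using x P by blast
  \<comment> \<open>perturb \<open>w\<close> so that its sublevel sets in the orthant become bounded\<close>
  define \<epsilon> where "\<epsilon> = (b - w \<bullet> x) / (2 * (coord_sum x + 1))"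
  have \<epsilon>: "\<epsilon> > 0" using w(1) coord_sum_nonneg[OF xo] by (simp add: \<epsilon>_def)
  have "\<epsilon> * (2 * (coord_sum x + 1)) = b - w \<bullet> x" using coord_sum_nonneg[OF xo] by (simp add: \<epsilon>_def)
  moreover have "\<epsilon> * coord_sum x \<ge> 0" using \<epsilon> coord_sum_nonneg[OF xo] by simp
  ultimately have "\<epsilon> * coord_sum x < b - w \<bullet> x" using \<epsilon> by (simp add: algebra_simps)
  define u where "u = w + \<epsilon> *\<^sub>R vec 1"
  have u: "u \<bullet> y = w \<bullet> y + \<epsilon> * coord_sum y" for y
    by (simp add: u_def inner_add_left coord_sum_eq_inner)
  have ux: "u \<bullet> x < b" using \<open>\<epsilon> * coord_sum x < b - w \<bullet> x\<close> by (simp add: u)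
  have uB: "u \<bullet> y > b" if "y \<in> B" for y
  proof -
    have "0 \<le> coord_sum y" using that B(1) by (intro coord_sum_nonneg) (auto simp: coconvex_def)
    then have "0 \<le> \<epsilon> * coord_sum y" using \<epsilon> by simp
    then show ?thesis using w(2)[OF that] by (simp add: u)
  qed
  have lower: "\<epsilon> * norm y \<le> u \<bullet> y" if "y \<in> positive_orthant" for y
  proof -
    have "0 \<le> w \<bullet> y"
      using that coconvex_halfspace_normal_nonneg[OF B(1) w(2)]
      by (auto simp: inner_vec_def positive_orthant_def intro!: sum_nonneg)
    moreover have "\<epsilon> * norm y \<le> \<epsilon> * coord_sum y" using \<epsilon> norm_le_coord_sum[OF that] by simp
    ultimately show ?thesis by (simp add: u)
  qed
  define S where "S = P \<inter> {y. u \<bullet> y \<le> u \<bullet> x}"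
  have "bounded S"
    unfolding bounded_iff
  proof (intro exI ballI)
    fix y assume "y \<in> S"
    then have "\<epsilon> * norm y \<le> u \<bullet> x" using lower[of y] P(2) by (auto simp: S_def)
    then show "norm y \<le> (u \<bullet> x) / \<epsilon>" using \<epsilon> by (simp add: field_simps)
  qed
  moreover have "closed S" unfolding S_def
    using polyhedron_imp_closed[OF poly] closed_halfspace_le by blast
  ultimately have "compact S" by (simp add: compact_eq_bounded_closed)
  moreover have "x \<in> S" using x by (simp add: S_def)
  moreover have "continuous_on S (\<lambda>y. u \<bullet> y)" by (intro continuous_intros)
  ultimately obtain z where z: "z \<in> S" "\<And>y. y \<in> S \<Longrightarrow> u \<bullet> z \<le> u \<bullet> y"
    using continuous_attains_inf[of S "\<lambda>y. u \<bullet> y"] by blast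
  \<comment> \<open>The face of minimisers is compact, so it has an extreme point, and extreme
    points of a face are extreme points of \<open>P\<close>.\<close>
  define T where "T = P \<inter> {y. u \<bullet> y = u \<bullet> z}"
  have min: "u \<bullet> y \<ge> u \<bullet> z" if "y \<in> P" for y
    using z(2)[of y] z(2)[OF \<open>x \<in> S\<close>] that by (cases "u \<bullet> y \<le> u \<bullet> x") (auto simp: S_def)
  have face: "T face_of P"
    unfolding T_def using polyhedron_imp_convex[OF poly] min by (intro face_of_Int_supporting_hyperplane_ge)
  have "T \<subseteq> S" using z(2)[OF \<open>x \<in> S\<close>] by (auto simp: T_def S_def)
  then have "bounded T" using \<open>bounded S\<close> bounded_subset by blast
  moreover have "closed T" unfolding T_def
    using polyhedron_imp_closed[OF poly] closed_hyperplane by blast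
  ultimately have "compact T" by (simp add: compact_eq_bounded_closed)
  moreover have "convex T" using face face_of_imp_convex by blast
  moreover have "z \<in> T" using z(1) by (simp add: T_def S_def)
  ultimately obtain v where v: "v extreme_point_of T" using extreme_point_exists_convex by blast
  then have "v \<in> T" "v extreme_point_of P" using extreme_point_of_face[OF face] by auto
  then have "v \<in> B" using lat P(1) by (auto simp: lattice_polyhedron_def T_def)
  then have "u \<bullet> v > b" by (rule uB)
  moreover have "u \<bullet> v = u \<bullet> z" using \<open>v \<in> T\<close> by (simp add: T_def)
  ultimately show False using z(2)[OF \<open>x \<in> S\<close>] ux by simp
qed

text \<open>The tuple \<open>D\<close>, obtained by adding one point of some
  \<open>B' i - B i\<close>, still lies below \<open>B'\<close>. Minimality would put its mixed
  volume below \<open>V\<close>, antimonotonicity puts it at \<open>V\<close> or above.\<close>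

lemma not_minimal_tuple_of_larger:
  fixes B B' :: "'n::finite \<Rightarrow> (real^'n) set"
  assumes B: "\<And>i. polyhedron (B i)" "\<And>i. B i \<subseteq> positive_orthant" "\<And>i. bounded (positive_orthant - B i)"
    and B': "\<And>i. polyhedron (B' i)" "\<And>i. B' i \<subseteq> positive_orthant" "\<And>i. bounded (positive_orthant - B' i)"
    and sub: "\<And>i. B i \<subseteq> B' i" and neq: "B \<noteq> B'"
    and V: "rel_mixed_volume positive_orthant B' = V"
  shows "\<not> minimal_tuple positive_orthant V B"
proof
  assume min: "minimal_tuple positive_orthant V B"
  obtain i \<delta> where i: "\<delta> \<in> B' i" "\<delta> \<notin> B i" using sub neq by blast
  have \<delta>: "\<delta> \<in> positive_orthant" using i(1) B'(2) by blast
  define D where "D = B(i := convex hull (B i \<union> {\<delta>}))"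
  \<comment> \<open>All conditions on the truncation level hold eventually, so one \<open>M\<close>
    serves both tuples and \<open>\<delta>\<close>.\<close>
  have "\<forall>\<^sub>F M in at_top. \<forall>k. coconvex M (B k)"
    by (intro eventually_all_finite eventually_coconvex B polyhedron_imp_convex)
  moreover have "\<forall>\<^sub>F M in at_top. \<forall>k. coconvex M (B' k)"
    by (intro eventually_all_finite eventually_coconvex B' polyhedron_imp_convex)
  moreover have "\<forall>\<^sub>F M in at_top. coord_sum \<delta> < M" by (rule eventually_gt_at_top)
  moreover have "\<forall>\<^sub>F M in at_top. (0::real) < M" by (rule eventually_gt_at_top)
  ultimately have "\<forall>\<^sub>F M in at_top. (\<forall>k. coconvex M (B k)) \<and> (\<forall>k. coconvex M (B' k)) \<and> coord_sum \<delta> < M \<and> 0 < M"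
    by eventually_elim blast
  then obtain M where M: "\<And>k. coconvex M (B k)" "\<And>k. coconvex M (B' k)" "coord_sum \<delta> < M" "0 < M"
    using eventually_happens'[OF trivial_limit_at_top_linorder] by blast
  have poly: "polytope (B k \<inter> corner_simplex M)" "polytope (B' k \<inter> corner_simplex M)" for k
    using B(1) B'(1) polytope_corner_simplex polyhedron_Int_polytope by blast+
  have "convex hull (B i \<union> {\<delta>}) \<subseteq> B' i"
    using i(1) sub polyhedron_imp_convex[OF B'(1)] by (intro hull_minimal) auto
  then have sub': "D k \<subseteq> B' k" for k using sub by (simp add: D_def)
  have co: "coconvex M (D k)" for k using M(1) coconvex_hull_insert[OF M(1) \<delta>] by (simp add: D_def)
  have poly': "polytope (D k \<inter> corner_simplex M)" for k
    using poly(1) polytope_truncated_hull_insert[OF M(1) poly(1) \<delta> M(3)] by (simp add: D_def)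
  have "V \<le> rel_mixed_volume positive_orthant D"
    unfolding V[symmetric] by (rule rel_mixed_volume_antimono[where M = M]) (fact co poly' M poly sub')+
  moreover have "rel_mixed_volume positive_orthant D < V"
    using min \<delta> i(2) by (auto simp: minimal_tuple_def D_def)
  ultimately show False by simp
qed

section \<open>Lattice points missed by a set, and the finiteness theorem\<close>

definition lattice_gap :: "(real^'n) set \<Rightarrow> ('n \<Rightarrow> nat) set" where
  "lattice_gap B = {f. (\<chi> j. real (f j)) \<notin> B}"

lemma finite_lattice_gap:
  fixes B :: "(real^'n) set"
  assumes "bounded (positive_orthant - B)"
  shows "finite (lattice_gap B)"
proof -
  obtain b where b: "\<And>x. x \<in> positive_orthant - B \<Longrightarrow> norm x \<le> b"
    using assms by (auto simp: bounded_iff)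
  have "f j \<le> nat \<lceil>b\<rceil>" if "f \<in> lattice_gap B" for f j
  proof -
    have "norm ((\<chi> j. real (f j)) :: real^'n) \<le> b"
      using that by (intro b) (simp add: lattice_gap_def positive_orthant_def)
    then have "real (f j) \<le> b" using component_le_norm_cart[of "(\<chi> j. real (f j)) :: real^'n" j] by simp
    then show ?thesis by linarith
  qed
  then have "lattice_gap B \<subseteq> {f. \<forall>j. f j \<in> {..nat \<lceil>b\<rceil>}}" by auto
  then show ?thesis using finite_function_set[OF finite_atMost] finite_subset by blast
qed

text \<open>The gap is the complement of an upward closed set.\<close>

lemma lattice_gap_downset:
  assumes B: "coconvex M B" and x: "x \<in> lattice_gap B" and le: "\<And>j. y j \<le> x j"
  shows "y \<in> lattice_gap B"
proof -
  have "(\<chi> j. real (y j)) + (\<chi> j. real (x j - y j)) \<in> B" if "(\<chi> j. real (y j)) \<in> B"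
    by (rule coconvex_upset[OF B that]) (simp add: positive_orthant_def)
  moreover have "(\<chi> j. real (y j)) + (\<chi> j. real (x j - y j)) = (\<chi> j. real (x j))"
    using le by (simp add: vec_eq_iff of_nat_diff)
  ultimately show ?thesis using x by (auto simp: lattice_gap_def)
qed

lemma lattice_point_not_in_gap:
  assumes "v \<in> positive_orthant" "\<forall>j. v $ j \<in> \<int>"
  shows "v \<in> B \<longleftrightarrow> (\<lambda>j. nat \<lfloor>v $ j\<rfloor>) \<notin> lattice_gap B"
proof -
  have "v = (\<chi> j. real (nat \<lfloor>v $ j\<rfloor>))"
    using assms by (simp add: vec_eq_iff positive_orthant_def of_nat_nat)
  then show ?thesis by (simp add: lattice_gap_def)
qed

theorem theorem7:
  fixes V :: real
  shows "finite {B :: 'n::finite \<Rightarrow> (real ^ 'n) set.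
           (\<forall>i. lattice_polyhedron (B i) \<and> B i \<subseteq> positive_orthant \<and>
                bounded (positive_orthant - B i)) \<and>
           minimal_tuple positive_orthant V B}" (is "finite ?\<B>")
proof (rule ccontr)
  assume "infinite ?\<B>"
  then obtain B :: "nat \<Rightarrow> 'n \<Rightarrow> (real^'n) set" where inj: "inj B" and range: "range B \<subseteq> ?\<B>"
    using infinite_countable_subset by blast
  have lat: "lattice_polyhedron (B k i)" and orth: "B k i \<subseteq> positive_orthant"
    and bdd: "bounded (positive_orthant - B k i)" and min: "minimal_tuple positive_orthant V (B k)" for k i
    using range by auto
  have poly: "polyhedron (B k i)" for k i using lat by (simp add: lattice_polyhedron_def)
  have co: "\<exists>M. coconvex M (B k i)" for k i
    by (rule eventually_happens'[OF trivial_limit_at_top_linorder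
          eventually_coconvex[OF orth polyhedron_imp_convex[OF poly] bdd]])
  have "\<exists>k l. k < l \<and> (\<forall>i. lattice_gap (B k i) \<subseteq> lattice_gap (B l i))"
  proof (rule tuples_of_finite_downsets_good_pair)
    show "finite (lattice_gap (B k i))" for k i using bdd by (rule finite_lattice_gap)
    fix k i x y assume x: "x \<in> lattice_gap (B k i)" and le: "\<And>j. y j \<le> x j"
    obtain M where "coconvex M (B k i)" using co by blast
    then show "y \<in> lattice_gap (B k i)" using x le by (rule lattice_gap_downset)
  qed
  then obtain k l where kl: "k < l" "\<And>i. lattice_gap (B k i) \<subseteq> lattice_gap (B l i)" by blast
  \<comment> \<open>Inclusion of the gaps reverses for the polyhedra: the later tuple
    \<open>B l\<close> is the smaller one, and it is the one that fails to be minimal.\<close>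
  have "B l i \<subseteq> B k i" for i
  proof -
    obtain M where "coconvex M (B k i)" using co by blast
    then show ?thesis
    proof (rule lattice_polyhedron_subset[OF lat orth _ polyhedron_imp_closed[OF poly]])
      fix v assume v: "v \<in> B l i" "\<forall>j. v $ j \<in> \<int>"
      then have gap: "v \<in> D \<longleftrightarrow> (\<lambda>j. nat \<lfloor>v $ j\<rfloor>) \<notin> lattice_gap D" for D
        using orth by (intro lattice_point_not_in_gap) auto
      show "v \<in> B k i" using v(1) kl(2) unfolding gap by (rule contra_subsetD[rotated])
    qed
  qed
  moreover have "B l \<noteq> B k" using inj kl(1) by (auto dest: injD)
  moreover have "rel_mixed_volume positive_orthant (B k) = V" using min by (simp add: minimal_tuple_def)
  ultimately have "\<not> minimal_tuple positive_orthant V (B l)"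
    by (intro not_minimal_tuple_of_larger[of "B l" "B k"] poly orth bdd)
  then show False using min by blast
qed

end
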